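(* Let $G$ be a graph with $m\ge 3$ edges. If $\lambda(G)\ge 1+\sqrt{m-2}$, then $$t(G)\ge m-2.$$ Moreover, equality holds if and only if $G=K_3\vee \frac{m-3}{3}K_1$ (up to isolated vertices).
   Context: Graphs are finite and simple. $\lambda(G)$ is the largest eigenvalue of the adjacency matrix $A(G)$, and $t(G)$ is the number of triangles of $G$. $G\vee H$ denotes the join of two vertex-disjoint graphs (all edges between them are added), and $kK_1$ is the graph with $k$ vertices and no edges ($k\ge 0$); the equality $G=K_3\vee \frac{m-3}{3}K_1$ means in particular that $\frac{m-3}{3}$ is an integer, and that $G$ is isomorphic to this graph. Isolated vertices are ignored in all extremal and equality statements (they do not affect $m$, $\lambda(G)$ or $t(G)$). *)

theory Defs
  imports
    "Graph_Theory.Graph_Theory"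
    "Jordan_Normal_Form.Char_Poly"
begin

text \<open>
  A finite simple graph is a \<open>pair_graph\<close>: a finite vertex set with a finite, symmetric,
  loop-free set of ordered pairs. Each undirected edge thus occurs as two arcs; below, edges and
  triangles are counted as 2-element and 3-element sets of vertices.
\<close>

definition edges :: "'a pair_pre_digraph \<Rightarrow> 'a set set" where
  "edges G = {{u, v} | u v. (u, v) \<in> parcs G}"

definition triangles :: "'a pair_pre_digraph \<Rightarrow> 'a set set" where
  "triangles G = {T. T \<subseteq> pverts G \<and> card T = 3 \<and>
     (\<forall>u\<in>T. \<forall>v\<in>T. u \<noteq> v \<longrightarrow> (u, v) \<in> parcs G)}"


subsection \<open>The largest adjacency eigenvalue\<close>

definition adjacency_matrix :: "'a pair_pre_digraph \<Rightarrow> 'a list \<Rightarrow> real mat" where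
  "adjacency_matrix G vs =
     mat (length vs) (length vs) (\<lambda>(i, j). if (vs ! i, vs ! j) \<in> parcs G then 1 else 0)"

definition vertex_order :: "'a pair_pre_digraph \<Rightarrow> 'a list" where
  "vertex_order G = (SOME vs. distinct vs \<and> set vs = pverts G)"

text \<open>
  The vertices are listed in an arbitrary order; by \<open>eigenvalue_adjacency_matrix_reorder\<close> below
  the eigenvalues do not depend on it.
\<close>

definition largest_eigenvalue :: "'a pair_pre_digraph \<Rightarrow> real" where
  "largest_eigenvalue G = Max {x. eigenvalue (adjacency_matrix G (vertex_order G)) x}"

lemma vertex_order:
  assumes "finite (pverts G)"
  shows "distinct (vertex_order G)" "set (vertex_order G) = pverts G"
proof -
  have "\<exists>vs. distinct vs \<and> set vs = pverts G"
    using finite_distinct_list[OF assms] by blast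
  then have "distinct (vertex_order G) \<and> set (vertex_order G) = pverts G"
    unfolding vertex_order_def by (rule someI_ex)
  then show "distinct (vertex_order G)" "set (vertex_order G) = pverts G" by auto
qed

lemma eigenvalue_adjacency_matrix_iff:
  assumes "distinct vs"
  shows "eigenvalue (adjacency_matrix G vs) x \<longleftrightarrow>
    (\<exists>f :: 'a \<Rightarrow> real. (\<exists>u\<in>set vs. f u \<noteq> 0) \<and>
       (\<forall>u\<in>set vs. (\<Sum>w\<in>set vs. if (u, w) \<in> parcs G then f w else 0) = x * f u))"
  (is "?L \<longleftrightarrow> ?R")
proof -
  let ?n = "length vs"
  let ?A = "adjacency_matrix G vs"
  have dim: "dim_row ?A = ?n" "dim_col ?A = ?n"
    by (auto simp: adjacency_matrix_def)
  have bij: "bij_betw ((!) vs) {0..<?n} (set vs)"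
    using bij_betw_nth[OF assms] by (metis atLeast0LessThan)
  have mult: "(?A *\<^sub>v vec ?n (\<lambda>i. f (vs ! i))) $ i =
      (\<Sum>w\<in>set vs. if (vs ! i, w) \<in> parcs G then f w else 0)" if "i < ?n" for f i
  proof -
    have "(?A *\<^sub>v vec ?n (\<lambda>i. f (vs ! i))) $ i =
        (\<Sum>j = 0..<?n. if (vs ! i, vs ! j) \<in> parcs G then f (vs ! j) else 0)"
      using that by (auto simp: adjacency_matrix_def scalar_prod_def intro!: sum.cong)
    also have "\<dots> = (\<Sum>w\<in>set vs. if (vs ! i, w) \<in> parcs G then f w else 0)"
      by (rule sum.reindex_bij_betw[OF bij])
    finally show ?thesis .
  qed
  have ev: "eigenvector ?A (vec ?n (\<lambda>i. f (vs ! i))) x \<longleftrightarrow>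
      (\<exists>u\<in>set vs. f u \<noteq> 0) \<and>
      (\<forall>u\<in>set vs. (\<Sum>w\<in>set vs. if (u, w) \<in> parcs G then f w else 0) = x * f u)" for f
  proof -
    have nz: "vec ?n (\<lambda>i. f (vs ! i)) \<noteq> 0\<^sub>v ?n \<longleftrightarrow> (\<exists>u\<in>set vs. f u \<noteq> 0)"
      by (auto simp: vec_eq_iff in_set_conv_nth Bex_def)
    have "?A *\<^sub>v vec ?n (\<lambda>i. f (vs ! i)) = x \<cdot>\<^sub>v vec ?n (\<lambda>i. f (vs ! i)) \<longleftrightarrow>
        (\<forall>i<?n. (?A *\<^sub>v vec ?n (\<lambda>i. f (vs ! i))) $ i = x * f (vs ! i))"
      by (auto simp: vec_eq_iff dim simp del: index_mult_mat_vec)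
    also have "\<dots> \<longleftrightarrow>
        (\<forall>u\<in>set vs. (\<Sum>w\<in>set vs. if (u, w) \<in> parcs G then f w else 0) = x * f u)"
      by (simp add: mult all_set_conv_all_nth del: index_mult_mat_vec)
    finally show ?thesis using nz by (simp add: eigenvector_def dim)
  qed
  show ?thesis
  proof
    assume ?L
    then obtain v where v: "eigenvector ?A v x" by (auto simp: eigenvalue_def)
    then have dv: "dim_vec v = ?n" by (auto simp: eigenvector_def dim)
    define f where "f = (\<lambda>u. v $ (the_inv_into {0..<?n} ((!) vs) u))"
    have "v = vec ?n (\<lambda>i. f (vs ! i))"
      using bij dv by (auto simp: f_def vec_eq_iff bij_betw_def the_inv_into_f_f)
    with v ev[of f] show ?R by metis
  next
    assume ?R
    then show ?L using ev unfolding eigenvalue_def by blast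
  qed
qed

lemma eigenvalue_adjacency_matrix_reorder:
  assumes "distinct vs" "distinct ws" "set vs = set ws"
  shows "eigenvalue (adjacency_matrix G vs) x \<longleftrightarrow> eigenvalue (adjacency_matrix G ws) x"
  using assms by (simp add: eigenvalue_adjacency_matrix_iff)


subsection \<open>The extremal graph\<close>

definition complete_graph :: "nat \<Rightarrow> nat pair_pre_digraph" where
  "complete_graph n = \<lparr>pverts = {..<n}, parcs = {(u, v). u < n \<and> v < n \<and> u \<noteq> v}\<rparr>"

definition empty_graph :: "nat \<Rightarrow> nat pair_pre_digraph" where
  "empty_graph n = \<lparr>pverts = {..<n}, parcs = {}\<rparr>"

definition graph_join :: "'a pair_pre_digraph \<Rightarrow> 'b pair_pre_digraph \<Rightarrow> ('a + 'b) pair_pre_digraph"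
  where "graph_join G H = \<lparr>pverts = pverts G <+> pverts H,
    parcs = {(Inl u, Inl v) | u v. (u, v) \<in> parcs G} \<union>
            {(Inr u, Inr v) | u v. (u, v) \<in> parcs H} \<union>
            {(Inl u, Inr v) | u v. u \<in> pverts G \<and> v \<in> pverts H} \<union>
            {(Inr v, Inl u) | u v. u \<in> pverts G \<and> v \<in> pverts H}\<rparr>"

definition delete_isolated :: "'a pair_pre_digraph \<Rightarrow> 'a pair_pre_digraph" where
  "delete_isolated G =
     \<lparr>pverts = {v \<in> pverts G. \<exists>u. (v, u) \<in> parcs G}, parcs = parcs G\<rparr>"

lemma pair_graph_complete_graph: "pair_graph (complete_graph n)"
proof -
  have "finite (parcs (complete_graph n))"
    by (rule finite_subset[of _ "{..<n} \<times> {..<n}"]) (auto simp: complete_graph_def)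
  then show ?thesis
    by unfold_locales (auto simp: complete_graph_def symmetric_def intro!: symI)
qed

lemma complete_digraph_complete_graph: "K\<^bsub>n\<^esub> (with_proj (complete_graph n))"
  unfolding complete_digraph_pair_def by (auto simp: complete_graph_def)

lemma pair_graph_empty_graph: "pair_graph (empty_graph n)"
  by unfold_locales (auto simp: empty_graph_def symmetric_def intro!: symI)

lemma pair_graph_graph_join:
  assumes "pair_graph G" "pair_graph H"
  shows "pair_graph (graph_join G H)"
proof -
  interpret G: pair_graph G by fact
  interpret H: pair_graph H by fact
  have "parcs (graph_join G H) \<subseteq> pverts (graph_join G H) \<times> pverts (graph_join G H)"
    by (auto simp: graph_join_def dest: G.wellformed' H.wellformed')
  moreover have "finite (pverts (graph_join G H))"
    by (simp add: graph_join_def G.pair_finite_verts H.pair_finite_verts)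
  ultimately have fin: "finite (parcs (graph_join G H))"
    by (meson finite_SigmaI finite_subset)
  have "sym (parcs G)" "sym (parcs H)"
    using G.pair_sym_arcs H.pair_sym_arcs by (auto simp: symmetric_def)
  then have "sym (parcs (graph_join G H))"
    by (auto simp: graph_join_def sym_def)
  with fin show ?thesis
    by unfold_locales
      (auto simp: graph_join_def symmetric_def G.pair_finite_verts H.pair_finite_verts
            dest: G.wellformed' H.wellformed' G.pair_no_loops H.pair_no_loops)
qed

end

theory Submission
  imports Defs "HOL-Analysis.Function_Topology"
begin

text \<open>
  Write \<open>s = sqrt (m - 2)\<close>, so that the hypothesis on the largest eigenvalue \<open>\<lambda>\<close> is \<open>\<lambda> \<ge> 1 + s\<close> and
  the claim is \<open>t \<ge> s\<^sup>2\<close> for the number \<open>t\<close> of triangles. The proof splits on whether the graph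
  contains a clique on four vertices.

  Without such a clique, weighted counting suffices. Let \<open>x \<ge> 0\<close> be an eigenvector for \<open>\<lambda>\<close>. A vertex
  adjacent to both ends of an edge closes a triangle, and a vertex is adjacent to at most two vertices
  of a triangle. Summing these two facts over all edges, respectively triangles, with weight \<open>x w\<close> at
  the vertex \<open>w\<close> yields \<open>\<lambda>^3 \<le> m \<lambda> + 2 t\<close> (\<open>largest_eigenvalue_cube_le\<close>), an inequality of Nikiforov.
  At \<open>\<lambda> \<ge> 1 + s\<close> it gives \<open>t \<ge> s\<^sup>2 + (s - 1) / 2\<close>, so equality forces \<open>s = 1\<close>: a single triangle.

  With a 4-clique the spectrum decides. The sum-zero vectors on the clique form a 3-dimensional
  space on which the quadratic form is \<open>- norm\<^sup>2\<close>, so at least three eigenvalues are at most \<open>- 1\<close>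
  (\<open>clique_forces_negative_eigenvalues\<close>). The squares of all eigenvalues sum to \<open>2 m\<close> and the cubes to
  \<open>6 t\<close>. The worst case is \<open>\<lambda> = 1 + s\<close> with the remaining square mass concentrated on the values
  \<open>1 - s, - 1, - 1\<close>, and there the cubes sum to exactly \<open>6 s\<^sup>2\<close> (\<open>cube_sum_bound\<close>).
  In the case of equality only four eigenvalues are nonzero. The rows of the adjacency matrix are then
  combinations of the four rows of the clique (\<open>clique_determines_kernel\<close>), which makes the graph,
  up to isolated vertices, complete 4-partite. Among these, \<open>t = m - 2\<close> holds only if at least three
  parts are singletons (\<open>triangle_join_if_complete_four_partite\<close>), that is, for a triangle joined to
  an independent set.

  The spectral theorem is obtained by maximising the Rayleigh quotient on spheres, which are compact
  in the product topology on functions.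
\<close>

section \<open>Eigenbases of symmetric kernels\<close>

text \<open>
  A symmetric matrix indexed by a finite set of vertices. Vectors are functions on the whole type that
  vanish outside \<open>V\<close>, so that equality of vectors is equality of functions.
\<close>

locale symmetric_kernel =
  fixes V :: "'a set" and a :: "'a \<Rightarrow> 'a \<Rightarrow> real"
  assumes finite_V: "finite V"
    and a_sym: "a v w = a w v"
begin

definition supported :: "('a \<Rightarrow> real) set" where
  "supported = {f. \<forall>v. v \<notin> V \<longrightarrow> f v = 0}"

definition ip :: "('a \<Rightarrow> real) \<Rightarrow> ('a \<Rightarrow> real) \<Rightarrow> real" where
  "ip f g = (\<Sum>v\<in>V. f v * g v)"

definition act :: "('a \<Rightarrow> real) \<Rightarrow> 'a \<Rightarrow> real" where
  "act f = (\<lambda>v. if v \<in> V then \<Sum>w\<in>V. a v w * f w else 0)"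

definition rayleigh :: "('a \<Rightarrow> real) \<Rightarrow> real" where
  "rayleigh f = ip (act f) f"

lemma ip_commute: "ip f g = ip g f"
  by (simp add: ip_def mult.commute)

lemma ip_add: "ip (\<lambda>v. f v + c * g v) h = ip f h + c * ip g h"
  by (simp add: ip_def sum.distrib algebra_simps sum_distrib_left)

lemma ip_scale: "ip (\<lambda>v. c * f v) h = c * ip f h"
  by (simp add: ip_def algebra_simps sum_distrib_left)

lemma ip_sum: "ip (\<lambda>v. \<Sum>i\<in>I. c i * f i v) h = (\<Sum>i\<in>I. c i * ip (f i) h)"
  by (simp add: ip_def sum_distrib_left sum_distrib_right sum.swap[of _ V] mult.assoc)

lemma ip_nonneg: "0 \<le> ip f f"
  by (simp add: ip_def sum_nonneg)

lemma ip_self_eq_0: "f \<in> supported \<Longrightarrow> ip f f = 0 \<Longrightarrow> f v = 0"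
  using finite_V by (cases "v \<in> V") (auto simp: ip_def supported_def sum_nonneg_eq_0_iff)

lemma act_supported: "act f \<in> supported"
  by (simp add: act_def supported_def)

lemma act_add: "act (\<lambda>v. f v + c * g v) = (\<lambda>v. act f v + c * act g v)"
  by (auto simp: act_def sum.distrib algebra_simps sum_distrib_left)

lemma act_scale: "act (\<lambda>v. c * f v) = (\<lambda>v. c * act f v)"
  by (auto simp: act_def algebra_simps sum_distrib_left)

lemma ip_act: "ip (act f) g = ip f (act g)"
proof -
  have "ip (act f) g = (\<Sum>v\<in>V. \<Sum>w\<in>V. a v w * f w * g v)"
    by (simp add: ip_def act_def sum_distrib_right)
  also have "\<dots> = (\<Sum>w\<in>V. \<Sum>v\<in>V. a v w * f w * g v)"
    by (rule sum.swap)
  also have "\<dots> = ip f (act g)"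
    using a_sym by (simp add: ip_def act_def sum_distrib_left mult_ac)
  finally show ?thesis .
qed

lemma rayleigh_add: "rayleigh (\<lambda>v. f v + c * g v) = rayleigh f + 2 * c * ip (act f) g + c\<^sup>2 * rayleigh g"
proof -
  have "ip (act g) f = ip (act f) g" by (metis ip_act ip_commute)
  moreover have "ip h (\<lambda>v. f v + c * g v) = ip h f + c * ip h g" for h
    using ip_add[of f c g h] by (simp add: ip_commute)
  ultimately show ?thesis
    by (simp add: rayleigh_def act_add ip_add algebra_simps power2_eq_square)
qed

lemma rayleigh_scale: "rayleigh (\<lambda>v. c * f v) = c\<^sup>2 * rayleigh f"
proof -
  have "ip (act f) (\<lambda>v. c * f v) = c * ip (act f) f"
    using ip_scale[of c f "act f"] by (simp add: ip_commute)
  then show ?thesis by (simp add: rayleigh_def act_scale ip_scale power2_eq_square)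
qed

definition maximiser :: "('a \<Rightarrow> real) set \<Rightarrow> ('a \<Rightarrow> real) \<Rightarrow> bool" where
  "maximiser U x \<longleftrightarrow> x \<in> supported \<and> ip x x = 1 \<and> (\<forall>u\<in>U. ip u x = 0) \<and>
     (\<forall>g\<in>supported. (\<forall>u\<in>U. ip u g = 0) \<longrightarrow> rayleigh g \<le> rayleigh x * ip g g)"

lemma continuous_on_ip: "continuous_on S (\<lambda>x. ip u x)"
  "continuous_on S (\<lambda>x. ip x x)"
  "continuous_on S rayleigh"
proof -
  have [continuous_intros]: "continuous_on S (\<lambda>x::'a \<Rightarrow> real. x v)" for v
    by (rule continuous_on_product_then_coordinatewise) (rule continuous_on_id)
  show "continuous_on S (\<lambda>x. ip u x)" "continuous_on S (\<lambda>x. ip x x)"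
    unfolding ip_def by (intro continuous_intros)+
  have "rayleigh x = (\<Sum>v\<in>V. (\<Sum>w\<in>V. a v w * x w) * x v)" for x
    by (simp add: rayleigh_def ip_def act_def)
  then have "rayleigh = (\<lambda>x. \<Sum>v\<in>V. (\<Sum>w\<in>V. a v w * x w) * x v)" by blast
  then show "continuous_on S rayleigh"
    by (simp only:) (intro continuous_intros)
qed

text \<open>
  The unit sphere of the complement of \<open>U\<close> is a closed subset of a product of compact intervals, and
  the Rayleigh form is continuous.
\<close>

lemma maximiser_exists:
  assumes f: "f \<in> supported" "f v \<noteq> 0" "\<forall>u\<in>U. ip u f = 0"
  shows "\<exists>x. maximiser U x"
proof -
  define Q :: "('a \<Rightarrow> real) set" where "Q = PiE UNIV (\<lambda>v. if v \<in> V then {-1..1} else {0})"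
  define S where "S = {x \<in> Q. ip x x = 1 \<and> (\<forall>u\<in>U. ip u x = 0)}"
  have "compactin (product_topology (\<lambda>_. euclidean) UNIV) Q"
    unfolding Q_def compactin_PiE by auto
  then have "compact Q"
    by (simp add: euclidean_product_topology)
  moreover have "closed {x. ip x x = 1}"
    by (intro closed_Collect_eq continuous_on_ip continuous_intros)
  moreover have "closed (\<Inter>u\<in>U. {x. ip u x = 0})"
    by (intro closed_INT ballI closed_Collect_eq continuous_on_ip continuous_intros)
  moreover have "S = Q \<inter> ({x. ip x x = 1} \<inter> (\<Inter>u\<in>U. {x. ip u x = 0}))"
    by (auto simp: S_def)
  ultimately have "compact S"
    by (simp add: compact_Int_closed closed_Int)
  have S_iff: "x \<in> S \<longleftrightarrow> x \<in> supported \<and> ip x x = 1 \<and> (\<forall>u\<in>U. ip u x = 0)" for x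
  proof
    assume "x \<in> S"
    then have "x v \<in> (if v \<in> V then {-1..1} else {0})" for v
      by (auto simp: S_def Q_def PiE_iff)
    then have "v \<notin> V \<Longrightarrow> x v = 0" for v by (metis singletonD)
    with \<open>x \<in> S\<close> show "x \<in> supported \<and> ip x x = 1 \<and> (\<forall>u\<in>U. ip u x = 0)"
      by (auto simp: S_def supported_def)
  next
    assume x: "x \<in> supported \<and> ip x x = 1 \<and> (\<forall>u\<in>U. ip u x = 0)"
    have "x v \<in> {-1..1}" if "v \<in> V" for v
    proof -
      have "x v * x v \<le> ip x x"
        unfolding ip_def by (rule member_le_sum[OF that]) (use finite_V in auto)
      then have "(x v)\<^sup>2 \<le> 1" using x by (simp add: power2_eq_square)
      then have "\<bar>x v\<bar> \<le> 1" by (simp add: abs_square_le_1)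
      then show ?thesis by auto
    qed
    then show "x \<in> S" using x by (auto simp: S_def Q_def supported_def PiE_iff)
  qed
  have normalise: "(\<lambda>v. inverse (sqrt (ip g g)) * g v) \<in> S"
    if "g \<in> supported" "ip g g \<noteq> 0" "\<forall>u\<in>U. ip u g = 0" for g
  proof -
    define c where "c = inverse (sqrt (ip g g))"
    have "c\<^sup>2 * ip g g = 1"
      using that ip_nonneg[of g] by (simp add: c_def power_inverse)
    moreover have "ip h (\<lambda>v. c * g v) = c * ip h g" for h
      using ip_scale[of c g h] by (simp add: ip_commute)
    ultimately show ?thesis
      using that by (auto simp: S_iff supported_def c_def[symmetric] ip_scale power2_eq_square)
  qed
  have "ip f f \<noteq> 0" using f ip_self_eq_0 by blast
  then have "S \<noteq> {}" using normalise f by blast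
  from continuous_attains_sup[OF \<open>compact S\<close> this continuous_on_ip(3)]
  obtain x where x: "x \<in> S" "\<forall>y\<in>S. rayleigh y \<le> rayleigh x" by blast
  have "rayleigh g \<le> rayleigh x * ip g g" if g: "g \<in> supported" "\<forall>u\<in>U. ip u g = 0" for g
  proof (cases "ip g g = 0")
    case True
    then have "g = (\<lambda>v. 0 * g v)" using ip_self_eq_0[OF g(1)] by auto
    then have "rayleigh g = 0" using rayleigh_scale[of 0 g] by simp
    then show ?thesis using True by simp
  next
    case False
    then have pos: "ip g g > 0" using ip_nonneg[of g] by simp
    have "rayleigh (\<lambda>v. inverse (sqrt (ip g g)) * g v) \<le> rayleigh x"
      using x(2) normalise[OF g(1) False g(2)] by blast
    then have "inverse (ip g g) * rayleigh g \<le> rayleigh x"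
      using pos by (simp add: rayleigh_scale power_inverse)
    then show ?thesis using pos by (simp add: field_simps)
  qed
  then show ?thesis using x(1) by (auto simp: maximiser_def S_iff)
qed

text \<open>
  Perturb \<open>x\<close> in the direction of its own defect \<open>h = act x - rayleigh x * x\<close>, which lies in the
  complement of \<open>U\<close> because the vectors of \<open>U\<close> are eigenvectors. The first-order change of the form,
  relative to the norm, is a positive multiple of \<open>ip h h\<close>, so maximality forces \<open>h = 0\<close>.
\<close>

lemma maximiser_eigenvector:
  assumes x: "maximiser U x"
    and U: "\<And>u. u \<in> U \<Longrightarrow> act u = (\<lambda>v. c u * u v)"
  shows "act x = (\<lambda>v. rayleigh x * x v)"
proof -
  define h where "h = (\<lambda>v. act x v + (- rayleigh x) * x v)"
  have xs: "x \<in> supported" "ip x x = 1" "\<And>u. u \<in> U \<Longrightarrow> ip u x = 0"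
    using x by (auto simp: maximiser_def)
  have hs: "h \<in> supported" using xs(1) act_supported[of x] by (auto simp: h_def supported_def)
  have hU: "ip u h = 0" if "u \<in> U" for u
  proof -
    have "ip u h = ip u (act x) - rayleigh x * ip u x"
      using ip_add[of "act x" "- rayleigh x" x u] by (simp add: h_def ip_commute)
    also have "ip u (act x) = ip (act u) x" by (simp add: ip_act)
    also have "\<dots> = c u * ip u x" by (simp add: U[OF that] ip_scale)
    finally show ?thesis using xs(3)[OF that] by simp
  qed
  have hh: "ip h h = ip (act x) h - rayleigh x * ip x h"
    using ip_add[of "act x" "- rayleigh x" x h] by (simp add: h_def)
  have key: "2 * e * ip h h \<le> e\<^sup>2 * (rayleigh x * ip h h - rayleigh h)" for e
  proof -
    let ?g = "\<lambda>v. x v + e * h v"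
    have "?g \<in> supported" using xs(1) hs by (auto simp: supported_def)
    moreover have "ip u ?g = 0" if "u \<in> U" for u
      using ip_add[of x e h u] xs(3)[OF that] hU[OF that] by (simp add: ip_commute)
    ultimately have "rayleigh ?g \<le> rayleigh x * ip ?g ?g" using x by (auto simp: maximiser_def)
    moreover have "ip ?g ?g = 1 + 2 * e * ip x h + e\<^sup>2 * ip h h"
      using ip_add[of x e h ?g] ip_add[of x e h x] ip_add[of x e h h] xs(2)
      by (simp add: ip_commute algebra_simps power2_eq_square)
    ultimately have "rayleigh x + 2 * e * ip (act x) h + e\<^sup>2 * rayleigh h
        \<le> rayleigh x * (1 + 2 * e * ip x h + e\<^sup>2 * ip h h)"
      by (simp add: rayleigh_add)
    moreover have "2 * e * ip h h = 2 * e * ip (act x) h - rayleigh x * (2 * e * ip x h)"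
      by (simp add: hh algebra_simps)
    ultimately show ?thesis by (simp add: distrib_left right_diff_distrib mult.left_commute)
  qed
  have "ip h h = 0"
  proof (rule ccontr)
    assume "ip h h \<noteq> 0"
    then have pos: "ip h h > 0" using ip_nonneg[of h] by simp
    define d where "d = rayleigh x * ip h h - rayleigh h"
    \<comment> \<open>In \<open>key\<close>, the linear term exceeds the quadratic one for small \<open>e > 0\<close>.\<close>
    define e where "e = ip h h / (\<bar>d\<bar> + 1)"
    have e: "e > 0" using pos by (simp add: e_def add_nonneg_pos)
    have "e * (2 * ip h h) \<le> e * (e * d)"
      using key[of e] by (simp add: d_def power2_eq_square algebra_simps)
    then have "2 * ip h h \<le> e * d" using e by simp
    also have "\<dots> \<le> e * (\<bar>d\<bar> + 1)" using e by (intro mult_left_mono) auto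
    also have "\<dots> = ip h h" by (simp add: e_def add_nonneg_eq_0_iff)
    finally show False using pos by simp
  qed
  then have "h v = 0" for v using ip_self_eq_0[OF hs] by blast
  then show ?thesis by (auto simp: h_def fun_eq_iff)
qed

definition eigensystem :: "('a \<Rightarrow> real) set \<Rightarrow> bool" where
  "eigensystem U \<longleftrightarrow> (\<forall>u\<in>U. u \<in> supported \<and> ip u u = 1 \<and> act u = (\<lambda>v. rayleigh u * u v)) \<and>
     (\<forall>u\<in>U. \<forall>w\<in>U. u \<noteq> w \<longrightarrow> ip u w = 0)"

text \<open>
  Bessel's inequality for the unit vector at \<open>v\<close> says that the squares \<open>(u v)\<^sup>2\<close> sum to at most 1;
  summing over all \<open>v\<close> counts the members of \<open>U\<close>.
\<close>

lemma card_eigensystem_le: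
  assumes "eigensystem U" "finite U"
  shows "card U \<le> card V"
proof -
  have "(\<Sum>u\<in>U. (u v)\<^sup>2) \<le> 1" if v: "v \<in> V" for v
  proof -
    \<comment> \<open>The component of the unit vector at \<open>v\<close> orthogonal to \<open>U\<close>.\<close>
    define f where "f = (\<lambda>w. (if w = v then 1 else 0::real) + (-1) * (\<Sum>u\<in>U. u v * u w))"
    have d: "ip (\<lambda>w. if w = v then 1 else 0::real) g = g v" for g
    proof -
      have "ip (\<lambda>w. if w = v then 1 else 0::real) g = (\<Sum>w\<in>V. if w = v then g w else 0)"
        unfolding ip_def by (rule sum.cong) auto
      then show ?thesis using v finite_V by simp
    qed
    define g where "g = (\<lambda>w. \<Sum>u\<in>U. u v * u w)"
    have ug: "ip u g = u v" if "u \<in> U" for u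
    proof -
      have "ip u g = (\<Sum>w\<in>U. w v * ip w u)"
        using ip_sum[of "\<lambda>u. u v" "\<lambda>u. u" U u] by (simp add: g_def ip_commute)
      also have "\<dots> = (\<Sum>w\<in>U. if w = u then w v else 0)"
        using assms that by (intro sum.cong) (auto simp: eigensystem_def)
      finally show ?thesis using assms that by simp
    qed
    have "ip g g = (\<Sum>u\<in>U. u v * ip u g)"
      using ip_sum[of "\<lambda>u. u v" "\<lambda>u. u" U g] by (simp add: g_def)
    also have "\<dots> = (\<Sum>u\<in>U. (u v)\<^sup>2)" using ug by (simp add: power2_eq_square)
    finally have gg: "ip g g = (\<Sum>u\<in>U. (u v)\<^sup>2)" .
    have gv: "g v = (\<Sum>u\<in>U. (u v)\<^sup>2)" by (simp add: g_def power2_eq_square)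
    have fg: "f = (\<lambda>w. (if w = v then 1 else 0::real) + (-1) * g w)" by (simp add: f_def g_def)
    have "ip f f = f v - ip g f"
      unfolding fg by (subst ip_add) (simp add: d)
    moreover have "ip g f = ip f g" by (rule ip_commute)
    moreover have "ip f g = g v - ip g g" unfolding fg by (subst ip_add) (simp add: d)
    moreover have "f v = 1 - g v" by (simp add: fg)
    ultimately show ?thesis using ip_nonneg[of f] gg gv by simp
  qed
  then have "(\<Sum>v\<in>V. \<Sum>u\<in>U. (u v)\<^sup>2) \<le> (\<Sum>v\<in>V. 1)" by (rule sum_mono)
  moreover have "(\<Sum>v\<in>V. \<Sum>u\<in>U. (u v)\<^sup>2) = (\<Sum>u\<in>U. ip u u)"
    by (subst sum.swap) (simp add: ip_def power2_eq_square)
  moreover have "(\<Sum>u\<in>U. ip u u) = card U" using assms by (simp add: eigensystem_def)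
  ultimately show ?thesis by simp
qed

definition eigenbasis :: "('a \<Rightarrow> real) set \<Rightarrow> bool" where
  "eigenbasis U \<longleftrightarrow> eigensystem U \<and> finite U \<and>
     (\<forall>f\<in>supported. (\<forall>u\<in>U. ip u f = 0) \<longrightarrow> f = (\<lambda>_. 0))"

text \<open>
  A system of maximal size is complete: otherwise a maximiser in its complement would enlarge it.
\<close>

lemma ex_eigenbasis: "\<exists>U. eigenbasis U"
proof -
  let ?P = "\<lambda>U. eigensystem U \<and> finite U"
  have "?P {}" by (simp add: eigensystem_def)
  moreover have "\<forall>U. ?P U \<longrightarrow> card U < Suc (card V)"
    using card_eigensystem_le by (auto simp: less_Suc_eq_le)
  ultimately have "\<exists>U. ?P U \<and> (\<forall>W. ?P W \<longrightarrow> card W \<le> card U)"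
    by (rule ex_has_greatest_nat)
  then obtain U where U: "eigensystem U" "finite U"
    and max: "\<And>W. eigensystem W \<Longrightarrow> finite W \<Longrightarrow> card W \<le> card U" by blast
  have "f = (\<lambda>_. 0)" if f: "f \<in> supported" "\<forall>u\<in>U. ip u f = 0" for f
  proof (rule ccontr)
    assume "f \<noteq> (\<lambda>_. 0)"
    then obtain v where "f v \<noteq> 0" by blast
    then obtain x where x: "maximiser U x" using maximiser_exists[of f v U] f by blast
    then have "act x = (\<lambda>v. rayleigh x * x v)"
      using maximiser_eigenvector[OF x, of rayleigh] U(1) by (auto simp: eigensystem_def)
    then have "eigensystem (insert x U)"
      using x U(1) by (auto simp: eigensystem_def maximiser_def ip_commute)
    moreover have "x \<notin> U" using x by (auto simp: maximiser_def)
    ultimately show False using max[of "insert x U"] U(2) by simp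
  qed
  then have "eigenbasis U" using U by (simp add: eigenbasis_def)
  then show ?thesis by blast
qed

lemma eigenbasisD:
  assumes "eigenbasis U"
  shows "finite U" "u \<in> U \<Longrightarrow> u \<in> supported" "u \<in> U \<Longrightarrow> ip u u = 1"
    "u \<in> U \<Longrightarrow> act u = (\<lambda>v. rayleigh u * u v)"
    "u \<in> U \<Longrightarrow> w \<in> U \<Longrightarrow> ip u w = (if u = w then 1 else 0)"
    "f \<in> supported \<Longrightarrow> (\<And>u. u \<in> U \<Longrightarrow> ip u f = 0) \<Longrightarrow> f = (\<lambda>_. 0)"
  using assms unfolding eigenbasis_def eigensystem_def by auto

lemma eigenbasis_expand:
  assumes U: "eigenbasis U" and f: "f \<in> supported"
  shows "f v = (\<Sum>u\<in>U. ip u f * u v)"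
proof -
  note B = eigenbasisD[OF U]
  define g where "g = (\<lambda>v. \<Sum>u\<in>U. ip u f * u v)"
  have "ip w g = ip w f" if "w \<in> U" for w
  proof -
    have "ip w g = (\<Sum>u\<in>U. ip u f * ip u w)"
      using ip_sum[of "\<lambda>u. ip u f" "\<lambda>u. u" U w] by (simp add: g_def ip_commute)
    also have "\<dots> = (\<Sum>u\<in>U. if u = w then ip u f else 0)"
      using B(5) that by (intro sum.cong) auto
    finally show ?thesis using B(1) that by simp
  qed
  moreover have "ip w (\<lambda>v. f v + (-1) * g v) = ip w f - ip w g" for w
    using ip_add[of f "-1" g w] by (simp add: ip_commute)
  moreover have "(\<lambda>v. f v + (-1) * g v) \<in> supported"
    using f B(2) by (auto simp: supported_def g_def intro!: sum.neutral)
  ultimately have "(\<lambda>v. f v + (-1) * g v) = (\<lambda>_. 0)" using B(6) by simp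
  then have "f v + (-1) * g v = 0" by meson
  then show ?thesis by (simp add: g_def)
qed

lemma ip_self_expand:
  assumes U: "eigenbasis U" and f: "f \<in> supported"
  shows "ip f f = (\<Sum>u\<in>U. (ip u f)\<^sup>2)"
proof -
  have "f = (\<lambda>v. \<Sum>u\<in>U. ip u f * u v)" using eigenbasis_expand[OF U f] by blast
  then have "ip f f = ip (\<lambda>v. \<Sum>u\<in>U. ip u f * u v) f" by simp
  also have "\<dots> = (\<Sum>u\<in>U. ip u f * ip u f)" by (rule ip_sum)
  finally show ?thesis by (simp add: power2_eq_square)
qed

lemma act_expand:
  assumes U: "eigenbasis U" and f: "f \<in> supported"
  shows "act f v = (\<Sum>u\<in>U. rayleigh u * ip u f * u v)"
proof -
  have "ip u (act f) = rayleigh u * ip u f" if "u \<in> U" for u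
  proof -
    have "ip u (act f) = ip (act u) f" by (simp add: ip_act)
    then show ?thesis by (simp add: eigenbasisD(4)[OF U that] ip_scale)
  qed
  then show ?thesis using eigenbasis_expand[OF U act_supported, of f v] by simp
qed

lemma rayleigh_expand:
  assumes U: "eigenbasis U" and f: "f \<in> supported"
  shows "rayleigh f = (\<Sum>u\<in>U. rayleigh u * (ip u f)\<^sup>2)"
proof -
  have "act f = (\<lambda>v. \<Sum>u\<in>U. (rayleigh u * ip u f) * u v)" using act_expand[OF U f] by blast
  then have "rayleigh f = ip (\<lambda>v. \<Sum>u\<in>U. (rayleigh u * ip u f) * u v) f" by (simp add: rayleigh_def)
  also have "\<dots> = (\<Sum>u\<in>U. rayleigh u * ip u f * ip u f)" by (rule ip_sum)
  finally show ?thesis by (simp add: power2_eq_square mult.assoc)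
qed

lemma kernel_expand:
  assumes U: "eigenbasis U" and "v \<in> V" "w \<in> V"
  shows "a v w = (\<Sum>u\<in>U. rayleigh u * u v * u w)"
proof -
  define f where "f = (\<lambda>z. if z = w then 1 else 0::real)"
  have f: "f \<in> supported" using assms by (auto simp: f_def supported_def)
  have "ip u f = u w" for u
    using assms(3) finite_V by (simp add: ip_def f_def if_distrib[of "(*) _"] cong: if_cong)
  moreover have "act f v = a v w"
    using assms finite_V by (simp add: act_def f_def if_distrib[of "(*) _"] cong: if_cong)
  ultimately show ?thesis using act_expand[OF U f, of v] by (simp add: mult_ac)
qed

text \<open>
  The kernel is the combination of the rank-one kernels \<open>u v * u w\<close> weighted by the eigenvalues; both
  trace formulas come from pairing this expansion with a second kernel \<open>b\<close>.
\<close>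

lemma sum_kernel_times:
  assumes U: "eigenbasis U"
  shows "(\<Sum>v\<in>V. \<Sum>w\<in>V. a v w * b v w) = (\<Sum>u\<in>U. rayleigh u * (\<Sum>v\<in>V. \<Sum>w\<in>V. u v * u w * b v w))"
proof -
  have "(\<Sum>v\<in>V. \<Sum>w\<in>V. a v w * b v w) = (\<Sum>v\<in>V. \<Sum>w\<in>V. \<Sum>u\<in>U. rayleigh u * (u v * u w * b v w))"
    by (intro sum.cong refl) (simp add: kernel_expand[OF U] sum_distrib_right mult.assoc)
  also have "\<dots> = (\<Sum>v\<in>V. \<Sum>u\<in>U. \<Sum>w\<in>V. rayleigh u * (u v * u w * b v w))"
    by (intro sum.cong refl sum.swap)
  also have "\<dots> = (\<Sum>u\<in>U. \<Sum>v\<in>V. \<Sum>w\<in>V. rayleigh u * (u v * u w * b v w))"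
    by (rule sum.swap)
  finally show ?thesis by (simp add: sum_distrib_left)
qed

lemma trace_square:
  assumes U: "eigenbasis U"
  shows "(\<Sum>v\<in>V. \<Sum>w\<in>V. a v w * a v w) = (\<Sum>u\<in>U. (rayleigh u)\<^sup>2)"
proof -
  have "(\<Sum>v\<in>V. \<Sum>w\<in>V. u v * u w * a v w) = rayleigh u" for u
    by (simp add: rayleigh_def ip_def act_def sum_distrib_left sum_distrib_right mult_ac)
  then show ?thesis by (simp add: sum_kernel_times[OF U] power2_eq_square)
qed

lemma trace_cube:
  assumes U: "eigenbasis U"
  shows "(\<Sum>v\<in>V. \<Sum>w\<in>V. \<Sum>z\<in>V. a v w * a w z * a z v) = (\<Sum>u\<in>U. (rayleigh u)^3)"
proof -
  have *: "(\<Sum>v\<in>V. \<Sum>w\<in>V. u v * u w * (\<Sum>z\<in>V. a w z * a z v)) = (rayleigh u)\<^sup>2" if "u \<in> U" for u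
  proof -
    have "(\<Sum>v\<in>V. \<Sum>w\<in>V. u v * u w * (\<Sum>z\<in>V. a w z * a z v))
        = (\<Sum>v\<in>V. \<Sum>w\<in>V. \<Sum>z\<in>V. (a z v * u v) * (a z w * u w))"
      by (simp add: sum_distrib_left mult_ac a_sym)
    also have "\<dots> = (\<Sum>v\<in>V. \<Sum>z\<in>V. \<Sum>w\<in>V. (a z v * u v) * (a z w * u w))"
      by (intro sum.cong refl sum.swap)
    also have "\<dots> = (\<Sum>z\<in>V. \<Sum>v\<in>V. \<Sum>w\<in>V. (a z v * u v) * (a z w * u w))"
      by (rule sum.swap)
    also have "\<dots> = ip (act u) (act u)"
      by (simp add: ip_def act_def sum_product)
    also have "\<dots> = rayleigh u * (rayleigh u * ip u u)"
      by (simp add: eigenbasisD(4)[OF U that] ip_scale ip_commute[of u "\<lambda>v. rayleigh u * u v"])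
    finally show ?thesis by (simp add: eigenbasisD(3)[OF U that] power2_eq_square)
  qed
  have "(\<Sum>v\<in>V. \<Sum>w\<in>V. \<Sum>z\<in>V. a v w * a w z * a z v)
      = (\<Sum>v\<in>V. \<Sum>w\<in>V. a v w * (\<Sum>z\<in>V. a w z * a z v))"
    by (simp add: sum_distrib_left mult.assoc)
  also have "\<dots> = (\<Sum>u\<in>U. rayleigh u * (rayleigh u)\<^sup>2)"
    by (simp add: sum_kernel_times[OF U] *)
  finally show ?thesis by (simp add: power3_eq_cube power2_eq_square mult.assoc)
qed

lemma eigenvalue_in_basis:
  assumes U: "eigenbasis U" and f: "f \<in> supported" "f v \<noteq> 0" "act f = (\<lambda>v. c * f v)"
  shows "\<exists>u\<in>U. rayleigh u = c"
proof (rule ccontr)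
  assume no: "\<not> ?thesis"
  have "ip u f = 0" if "u \<in> U" for u
  proof -
    have "rayleigh u * ip u f = ip (act u) f"
      by (simp add: eigenbasisD(4)[OF U that] ip_scale)
    also have "\<dots> = ip (act f) u" by (rule trans[OF ip_act ip_commute])
    also have "\<dots> = c * ip u f" by (simp only: f(3) ip_scale ip_commute)
    finally have "rayleigh u * ip u f = c * ip u f" .
    then show ?thesis using no that by auto
  qed
  then show False using eigenbasisD(6)[OF U f(1)] f(2) by metis
qed

text \<open>
  Taking absolute values does not decrease the Rayleigh form of a nonnegative kernel, so the absolute
  value of a maximiser is again one, and hence an eigenvector.
\<close>

lemma nonnegative_top_eigenvector:
  assumes a0: "\<And>v w. 0 \<le> a v w" and "V \<noteq> {}"
  shows "\<exists>x\<in>supported. (\<forall>v. 0 \<le> x v) \<and> ip x x = 1 \<and> act x = (\<lambda>v. rayleigh x * x v) \<and>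
    (\<forall>f\<in>supported. rayleigh f \<le> rayleigh x * ip f f)"
proof -
  obtain v where v: "v \<in> V" using assms(2) by blast
  obtain y where y: "maximiser {} y"
    using maximiser_exists[of "\<lambda>w. if w = v then 1 else 0" v "{}"] v
    by (force simp: supported_def)
  define x where "x = (\<lambda>v. \<bar>y v\<bar>)"
  have xs: "x \<in> supported" "ip x x = 1" using y by (auto simp: x_def maximiser_def supported_def ip_def)
  have "rayleigh y \<le> rayleigh x"
  proof -
    have "(\<Sum>w\<in>V. a v w * y w) * y v \<le> (\<Sum>w\<in>V. a v w * x w) * x v" for v
    proof -
      have "(\<Sum>w\<in>V. a v w * y w) * y v \<le> \<bar>\<Sum>w\<in>V. a v w * y w\<bar> * \<bar>y v\<bar>"
        by (metis abs_ge_self abs_mult)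
      also have "\<dots> \<le> (\<Sum>w\<in>V. \<bar>a v w * y w\<bar>) * \<bar>y v\<bar>"
        by (intro mult_right_mono sum_abs) auto
      finally show ?thesis using a0 by (simp add: abs_mult x_def)
    qed
    then show ?thesis by (simp add: rayleigh_def ip_def act_def sum_mono)
  qed
  moreover have top: "rayleigh f \<le> rayleigh y * ip f f" if "f \<in> supported" for f
    using y that by (auto simp: maximiser_def)
  ultimately have "rayleigh x = rayleigh y" using xs top[of x] by simp
  then have x: "maximiser {} x" using y xs by (auto simp: maximiser_def)
  have "act x = (\<lambda>v. rayleigh x * x v)" by (rule maximiser_eigenvector[OF x]) auto
  then show ?thesis
    using x by (intro bexI[of _ x]) (auto simp: maximiser_def x_def)
qed

end

section \<open>Linear relations and cliques\<close>

text \<open>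
  Gaussian elimination: an equation with a nonzero coefficient removes one unknown from the others.
\<close>

lemma underdetermined_system_solution:
  fixes \<phi> :: "'e \<Rightarrow> 'j \<Rightarrow> real"
  assumes "finite E" "finite J" "card E < card J"
  shows "\<exists>c. (\<exists>j\<in>J. c j \<noteq> 0) \<and> (\<forall>e\<in>E. (\<Sum>j\<in>J. c j * \<phi> e j) = 0)"
  using assms
proof (induction E arbitrary: J \<phi> rule: finite_induct)
  case empty
  then obtain j where "j \<in> J" by fastforce
  then show ?case by (intro exI[of _ "\<lambda>_. 1"]) auto
next
  case (insert e E)
  show ?case
  proof (cases "\<forall>j\<in>J. \<phi> e j = 0")
    case True
    then show ?thesis using insert.IH[of J \<phi>] insert.prems insert.hyps by auto
  next
    case False
    then obtain p where p: "p \<in> J" "\<phi> e p \<noteq> 0" by blast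
    \<comment> \<open>The coefficients after eliminating the unknown \<open>p\<close> by means of equation \<open>e\<close>.\<close>
    define \<psi> where "\<psi> = (\<lambda>e' j. \<phi> e' j - \<phi> e' p * \<phi> e j / \<phi> e p)"
    have "card E < card (J - {p})" using insert p by simp
    then obtain c where c: "\<exists>j\<in>J - {p}. c j \<noteq> 0"
      "\<And>e'. e' \<in> E \<Longrightarrow> (\<Sum>j\<in>J - {p}. c j * \<psi> e' j) = 0"
      using insert.IH[of "J - {p}" \<psi>] insert.prems by auto
    define s where "s = (\<Sum>j\<in>J - {p}. c j * \<phi> e j)"
    define d where "d = c(p := - s / \<phi> e p)"
    have split: "(\<Sum>j\<in>J. d j * \<phi> e' j) = - s / \<phi> e p * \<phi> e' p + (\<Sum>j\<in>J - {p}. c j * \<phi> e' j)" for e'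
    proof -
      have "(\<Sum>j\<in>J. d j * \<phi> e' j) = d p * \<phi> e' p + (\<Sum>j\<in>J - {p}. d j * \<phi> e' j)"
        using p insert.prems by (simp add: sum.remove)
      also have "(\<Sum>j\<in>J - {p}. d j * \<phi> e' j) = (\<Sum>j\<in>J - {p}. c j * \<phi> e' j)"
        by (rule sum.cong) (auto simp: d_def)
      finally show ?thesis by (simp add: d_def)
    qed
    have "(\<Sum>j\<in>J. d j * \<phi> e j) = 0"
      using p by (simp add: split s_def[symmetric])
    moreover have "(\<Sum>j\<in>J. d j * \<phi> e' j) = 0" if "e' \<in> E" for e'
    proof -
      have "(\<Sum>j\<in>J - {p}. c j * \<psi> e' j) = (\<Sum>j\<in>J - {p}. c j * \<phi> e' j - \<phi> e' p / \<phi> e p * (c j * \<phi> e j))"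
        by (rule sum.cong) (auto simp: \<psi>_def algebra_simps)
      also have "\<dots> = (\<Sum>j\<in>J - {p}. c j * \<phi> e' j) - \<phi> e' p / \<phi> e p * s"
        by (simp add: sum_subtractf sum_distrib_left s_def)
      finally show ?thesis using c(2)[OF that] by (simp add: split)
    qed
    moreover have "\<exists>j\<in>J. d j \<noteq> 0" using c(1) by (auto simp: d_def)
    ultimately show ?thesis by blast
  qed
qed

context symmetric_kernel
begin

text \<open>
  This is one half of Cauchy interlacing. If there were fewer such eigenvalues, some nonzero vector
  \<open>f\<close> on \<open>K\<close> with coordinate sum 0 would be orthogonal to all their eigenvectors. Then
  \<open>rayleigh f = - ip f f\<close> by the clique structure, while the eigenvalues that occur in \<open>f\<close> all exceed
  \<open>- 1\<close>.
\<close>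

lemma clique_forces_negative_eigenvalues:
  assumes U: "eigenbasis U" and K: "K \<subseteq> V"
    and clique: "\<And>i j. i \<in> K \<Longrightarrow> j \<in> K \<Longrightarrow> a i j = (if i = j then 0 else 1)"
  shows "card K \<le> card {u \<in> U. rayleigh u \<le> -1} + 1"
proof (rule ccontr)
  assume contr: "\<not> ?thesis"
  define N where "N = {u \<in> U. rayleigh u \<le> -1}"
  have finK: "finite K" using K finite_V by (rule finite_subset)
  have finN: "finite N" using eigenbasisD(1)[OF U] by (simp add: N_def)
  \<comment> \<open>One equation for the coordinate sum, and one for each eigenvector in \<open>N\<close>.\<close>
  define E where "E = insert None (Some ` N)"
  define \<phi> :: "('a \<Rightarrow> real) option \<Rightarrow> 'a \<Rightarrow> real" where
    "\<phi> = (\<lambda>e j. case e of None \<Rightarrow> 1 | Some u \<Rightarrow> u j)"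
  have "card E = card N + 1" using finN by (simp add: E_def card_image)
  then have "card E < card K" using contr by (simp add: N_def)
  then obtain c where c: "\<exists>j\<in>K. c j \<noteq> 0" "\<And>e. e \<in> E \<Longrightarrow> (\<Sum>j\<in>K. c j * \<phi> e j) = 0"
    using underdetermined_system_solution[of E K \<phi>] finK finN by (auto simp: E_def)
  have sum0: "(\<Sum>j\<in>K. c j) = 0" using c(2)[of None] by (simp add: E_def \<phi>_def)
  define f where "f = (\<lambda>v. if v \<in> K then c v else 0)"
  have f: "f \<in> supported" using K by (auto simp: f_def supported_def)
  have onK: "(\<Sum>v\<in>V. g v * f v) = (\<Sum>v\<in>K. g v * c v)" for g
    using K finite_V by (intro sum.mono_neutral_cong_right) (auto simp: f_def)
  have ipN: "ip u f = 0" if "u \<in> N" for u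
    using c(2)[of "Some u"] that onK[of u] by (simp add: E_def \<phi>_def ip_def mult.commute)
  have "act f v = - f v" if "v \<in> K" for v
  proof -
    have "act f v = (\<Sum>w\<in>K. a v w * c w)" using that K by (auto simp: act_def onK)
    also have "\<dots> = (\<Sum>w\<in>K. c w - (if w = v then c w else 0))"
      using clique that by (intro sum.cong) auto
    also have "\<dots> = - c v" using finK that by (simp add: sum_subtractf sum0)
    finally show ?thesis using that by (simp add: f_def)
  qed
  then have "rayleigh f = (\<Sum>v\<in>K. - f v * c v)" by (simp add: rayleigh_def ip_def onK)
  also have "\<dots> = - ip f f" using onK[of f] by (simp add: ip_def sum_negf)
  finally have "(\<Sum>u\<in>U. (rayleigh u + 1) * (ip u f)\<^sup>2) = 0"
    using rayleigh_expand[OF U f] ip_self_expand[OF U f] by (simp add: distrib_right sum.distrib)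
  moreover have "0 \<le> (rayleigh u + 1) * (ip u f)\<^sup>2" if "u \<in> U" for u
    using ipN[of u] that by (cases "u \<in> N") (auto simp: N_def)
  ultimately have "\<forall>u\<in>U. (rayleigh u + 1) * (ip u f)\<^sup>2 = 0"
    using eigenbasisD(1)[OF U] by (simp add: sum_nonneg_eq_0_iff)
  then have "ip u f = 0" if "u \<in> U" for u
    using ipN[of u] that by (cases "u \<in> N") (auto simp: N_def)
  then have "f = (\<lambda>_. 0)" using eigenbasisD(6)[OF U f] by blast
  then show False using c(1) unfolding f_def by metis
qed

text \<open>
  A \<open>k\<close>-clique has the matrix \<open>J - I\<close>, where all entries of \<open>J\<close> are 1, and \<open>J - I\<close> is invertible. If
  the whole kernel has rank \<open>k\<close>, each row is therefore a combination of the clique rows, with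
  coefficients read off from its values on the clique.
  Inserting the inverse \<open>J / (k - 1) - I\<close> gives the stated formula, cleared of denominators.
\<close>

lemma clique_determines_kernel:
  assumes U: "eigenbasis U" and K: "K \<subseteq> V" "card K \<ge> 2"
    and clique: "\<And>i j. i \<in> K \<Longrightarrow> j \<in> K \<Longrightarrow> a i j = (if i = j then 0 else 1)"
    and rank: "card {u \<in> U. rayleigh u \<noteq> 0} \<le> card K"
    and vw: "v \<in> V" "w \<in> V"
  shows "(real (card K) - 1) * (a v w + (\<Sum>i\<in>K. a v i * a i w)) = (\<Sum>i\<in>K. a v i) * (\<Sum>i\<in>K. a i w)"
proof -
  have finK: "finite K" using K finite_V finite_subset by blast
  have row: "(\<Sum>k\<in>K. c k * a k i) = (\<Sum>k\<in>K. c k) - c i" if "i \<in> K" for c i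
  proof -
    have "(\<Sum>k\<in>K. c k * a k i) = (\<Sum>k\<in>K. c k - (if k = i then c k else 0))"
      using clique that by (intro sum.cong) auto
    then show ?thesis using finK that by (simp add: sum_subtractf)
  qed
  show ?thesis
  proof (cases "v \<in> K")
    case True
    have "(\<Sum>i\<in>K. a v i) = real (card K) - 1"
      using row[OF True, of "\<lambda>_. 1"] by (simp add: a_sym)
    moreover have "(\<Sum>i\<in>K. a v i * a i w) = (\<Sum>i\<in>K. a i w) - a v w"
      using row[OF True, of "\<lambda>i. a i w"] by (simp add: a_sym mult.commute)
    ultimately show ?thesis by simp
  next
    case False
    define E where "E = {u \<in> U. rayleigh u \<noteq> 0}"
    have "finite E" using eigenbasisD(1)[OF U] by (simp add: E_def)
    moreover have "card E < card (insert v K)" using rank finK False by (simp add: E_def)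
    ultimately obtain c where c: "\<exists>j\<in>insert v K. c j \<noteq> 0"
      "\<And>u. u \<in> E \<Longrightarrow> (\<Sum>j\<in>insert v K. c j * u j) = 0"
      using underdetermined_system_solution[of E "insert v K" "\<lambda>u. u"] finK by auto
    have rel: "c v * a v z + (\<Sum>k\<in>K. c k * a k z) = 0" if z: "z \<in> V" for z
    proof -
      have "(\<Sum>j\<in>insert v K. c j * a j z) = (\<Sum>j\<in>insert v K. \<Sum>u\<in>U. rayleigh u * u z * (c j * u j))"
      proof (rule sum.cong[OF refl])
        fix j assume "j \<in> insert v K"
        then have "j \<in> V" using K vw by auto
        then show "c j * a j z = (\<Sum>u\<in>U. rayleigh u * u z * (c j * u j))"
          using z by (simp add: kernel_expand[OF U, of j z] sum_distrib_left mult_ac)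
      qed
      also have "\<dots> = (\<Sum>u\<in>U. rayleigh u * u z * (\<Sum>j\<in>insert v K. c j * u j))"
        by (subst sum.swap) (simp only: sum_distrib_left)
      also have "\<dots> = 0" by (rule sum.neutral) (use c(2) in \<open>auto simp: E_def\<close>)
      finally show ?thesis using finK False by simp
    qed
    have cv: "c v \<noteq> 0"
    proof
      assume 0: "c v = 0"
      \<comment> \<open>A relation among the clique rows alone is impossible since \<open>J - I\<close> is invertible.\<close>
      define D where "D = (\<Sum>k\<in>K. c k)"
      have cD: "c i = D" if "i \<in> K" for i
        using rel[of i] row[OF that, of c] that K 0 by (auto simp: D_def)
      have "D = (\<Sum>k\<in>K. D)" using cD by (metis D_def sum.cong)
      then have "D = real (card K) * D" by simp
      then have "D = 0" using K(2) by auto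
      then show False using c(1) cD 0 by auto
    qed
    define d where "d k = - c k / c v" for k
    have avz: "a v z = (\<Sum>k\<in>K. d k * a k z)" if "z \<in> V" for z
    proof -
      have "(\<Sum>k\<in>K. d k * a k z) = - (\<Sum>k\<in>K. c k * a k z) / c v"
        by (simp add: d_def sum_divide_distrib sum_negf)
      also have "(\<Sum>k\<in>K. c k * a k z) = - (c v * a v z)" using rel[OF that] by linarith
      finally show ?thesis using cv by simp
    qed
    define D where "D = (\<Sum>k\<in>K. d k)"
    have di: "d i = D - a v i" if "i \<in> K" for i
      using avz[of i] row[OF that, of d] that K by (auto simp: D_def)
    have "D = (\<Sum>i\<in>K. D - a v i)" using di by (metis D_def sum.cong)
    then have \<beta>: "(\<Sum>i\<in>K. a v i) = (real (card K) - 1) * D"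
      by (simp add: sum_subtractf algebra_simps)
    have "a v w = (\<Sum>k\<in>K. (D - a v k) * a k w)" using avz[OF vw(2)] di by simp
    also have "\<dots> = D * (\<Sum>k\<in>K. a k w) - (\<Sum>k\<in>K. a v k * a k w)"
      by (simp add: left_diff_distrib sum_subtractf sum_distrib_left)
    finally have "a v w + (\<Sum>i\<in>K. a v i * a i w) = D * (\<Sum>i\<in>K. a i w)" by simp
    then show ?thesis by (simp add: \<beta>)
  qed
qed

end

section \<open>Sums of cubes of eigenvalues\<close>

text \<open>
  Add \<open>\<sigma>\<close> times the squares to the cubes, where \<open>\<sigma>\<close> is chosen such that \<open>p z = z^3 + \<sigma> z\<^sup>2\<close> takes the
  same value \<open>\<sigma> - 1\<close> at \<open>- 1\<close> and at \<open>- q = 1 - s\<close>. On the interval between these points \<open>p\<close> is at least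
  \<open>\<sigma> - 1\<close>, and it is nonnegative from \<open>- \<sigma>\<close>, hence from \<open>- q\<close>, upwards. The fixed sum of squares leaves
  no room for a value below \<open>- q\<close> beside \<open>r e\<close> and two further values of at most \<open>- 1\<close>. So \<open>e\<close> and three
  negative values contribute at least \<open>p (1 + s) + 3 (\<sigma> - 1)\<close> and everything else at least 0. In the
  case of equality everything else is a zero of \<open>p\<close> above \<open>- \<sigma>\<close>, which is 0.
\<close>

lemma cube_sum_bound:
  fixes r :: "'b \<Rightarrow> real" and s :: real
  assumes U: "finite U" and e: "e \<in> U" "r e \<ge> 1 + s" and s: "s \<ge> 2"
    and neg: "card {u \<in> U. r u \<le> -1} \<ge> 3"
    and squares: "(\<Sum>u\<in>U. (r u)\<^sup>2) = 2 * (s\<^sup>2 + 2)"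
  shows "(\<Sum>u\<in>U. r u ^ 3) \<ge> 6 * s\<^sup>2"
    and "(\<Sum>u\<in>U. r u ^ 3) = 6 * s\<^sup>2 \<Longrightarrow> card {u \<in> U. r u \<noteq> 0} \<le> 4"
proof -
  define N where "N = {u \<in> U. r u \<le> -1}"
  have finN: "finite N" using U by (simp add: N_def)
  define q where "q = s - 1"
  define \<sigma> where "\<sigma> = (q\<^sup>2 + q + 1) / (q + 1)"
  define p where "p = (\<lambda>z::real. z ^ 3 + \<sigma> * z\<^sup>2)"
  have q: "q \<ge> 1" using s by (simp add: q_def)
  have \<sigma>q: "\<sigma> * (q + 1) = q\<^sup>2 + q + 1" using q by (simp add: \<sigma>_def)
  have \<sigma>: "\<sigma> > q"
  proof -
    have "q * (q + 1) < \<sigma> * (q + 1)" unfolding \<sigma>q by (simp add: power2_eq_square algebra_simps)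
    then show ?thesis using q by simp
  qed
  have sq1: "(1 + s)\<^sup>2 \<le> (r e)\<^sup>2" using e(2) s by (intro power_mono) auto
  have lower: "- q \<le> r u" if u: "u \<in> U" for u
  proof (rule ccontr)
    assume "\<not> ?thesis"
    then have ru: "r u < - q" by simp
    then have uN: "u \<in> N" using u q by (simp add: N_def)
    then have "card (N - {u}) \<ge> 2" using neg finN by (simp add: N_def[symmetric])
    then obtain C where C: "C \<subseteq> N - {u}" "card C = 2" "finite C"
      by (meson obtain_subset_with_card_n)
    have "q\<^sup>2 < (r u)\<^sup>2" using ru q power_strict_mono[of q "- r u" 2] by simp
    moreover have "(\<Sum>v\<in>C. 1) \<le> (\<Sum>v\<in>C. (r v)\<^sup>2)"
    proof (rule sum_mono)
      fix v assume "v \<in> C"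
      then have "1 \<le> - r v" using C by (auto simp: N_def)
      then show "1 \<le> (r v)\<^sup>2" using one_le_power[of "- r v" 2] by simp
    qed
    moreover have "e \<notin> C" "e \<noteq> u" "u \<notin> C" using C e s uN by (auto simp: N_def)
    then have "(\<Sum>v\<in>insert e (insert u C). (r v)\<^sup>2) = (r e)\<^sup>2 + (r u)\<^sup>2 + (\<Sum>v\<in>C. (r v)\<^sup>2)"
      using C by simp
    moreover have "(\<Sum>v\<in>insert e (insert u C). (r v)\<^sup>2) \<le> (\<Sum>v\<in>U. (r v)\<^sup>2)"
      using U e u C by (intro sum_mono2) (auto simp: N_def)
    ultimately have "(1 + s)\<^sup>2 + q\<^sup>2 + 2 < 2 * (s\<^sup>2 + 2)" using sq1 squares C(2) by simp
    then show False by (simp add: q_def power2_eq_square algebra_simps)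
  qed
  have p_nonneg: "0 \<le> p (r u)" if "u \<in> U" for u
  proof -
    have "p (r u) = (r u)\<^sup>2 * (r u + \<sigma>)"
      by (simp add: p_def power2_eq_square power3_eq_cube algebra_simps)
    then show ?thesis using lower[OF that] \<sigma> by simp
  qed
  have p_neg: "\<sigma> - 1 \<le> p (r u)" if "u \<in> N" for u
  proof -
    define b where "b = - r u"
    have b: "1 \<le> b" "b \<le> q" using that lower[of u] by (auto simp: N_def b_def)
    have "(q + 1) * (\<sigma> * (b + 1) - (b\<^sup>2 + b + 1)) = (\<sigma> * (q + 1)) * (b + 1) - (b\<^sup>2 + b + 1) * (q + 1)"
      by (simp add: algebra_simps)
    also have "\<dots> = (q - b) * (q * b + q + b)"
      unfolding \<sigma>q by (simp add: power2_eq_square algebra_simps)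
    finally have "0 \<le> (q + 1) * (\<sigma> * (b + 1) - (b\<^sup>2 + b + 1))" using b q by simp
    then have "0 \<le> \<sigma> * (b + 1) - (b\<^sup>2 + b + 1)" using q by (simp add: zero_le_mult_iff)
    then have "0 \<le> (b - 1) * (\<sigma> * (b + 1) - (b\<^sup>2 + b + 1))" using b by simp
    also have "\<dots> = p (r u) - (\<sigma> - 1)"
      by (simp add: p_def b_def power2_eq_square power3_eq_cube algebra_simps)
    finally show ?thesis by simp
  qed
  have sum_p: "(\<Sum>u\<in>U. p (r u)) = (\<Sum>u\<in>U. r u ^ 3) + \<sigma> * (2 * (s\<^sup>2 + 2))"
    by (simp add: p_def sum.distrib sum_distrib_left[symmetric] squares)
  have p_top: "p (1 + s) \<le> p (r e)"
  proof -
    have "(1 + s) ^ 3 \<le> r e ^ 3" using e(2) s by (intro power_mono) auto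
    moreover have "\<sigma> * (1 + s)\<^sup>2 \<le> \<sigma> * (r e)\<^sup>2" using sq1 \<sigma> q by (intro mult_left_mono) auto
    ultimately show ?thesis by (simp add: p_def)
  qed
  have const: "p (1 + s) + 3 * (\<sigma> - 1) - \<sigma> * (2 * (s\<^sup>2 + 2)) = 6 * s\<^sup>2"
  proof -
    have "p (1 + s) + 3 * (\<sigma> - 1) - \<sigma> * (2 * (s\<^sup>2 + 2)) = (q + 2) ^ 3 - 3 - (\<sigma> * (q + 1)) * (q - 1)"
      by (simp add: p_def q_def power2_eq_square power3_eq_cube algebra_simps)
    also have "\<dots> = 6 * s\<^sup>2"
      unfolding \<sigma>q by (simp add: q_def power2_eq_square power3_eq_cube algebra_simps)
    finally show ?thesis .
  qed
  obtain C where C: "C \<subseteq> N" "card C = 3" "finite C"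
    using neg obtain_subset_with_card_n[of 3 N] by (auto simp: N_def)
  have eC: "e \<notin> C" using C e s by (auto simp: N_def)
  have sub: "insert e C \<subseteq> U" using e C by (auto simp: N_def)
  have "(\<Sum>u\<in>C. \<sigma> - 1) \<le> (\<Sum>u\<in>C. p (r u))" using p_neg C by (intro sum_mono) auto
  then have main: "(\<Sum>u\<in>insert e C. p (r u)) \<ge> p (1 + s) + 3 * (\<sigma> - 1)"
    using eC C p_top by simp
  have split: "(\<Sum>u\<in>U. p (r u)) = (\<Sum>u\<in>U - insert e C. p (r u)) + (\<Sum>u\<in>insert e C. p (r u))"
    by (rule sum.subset_diff[OF sub U])
  have rest: "0 \<le> (\<Sum>u\<in>U - insert e C. p (r u))" using p_nonneg by (intro sum_nonneg) auto
  show "(\<Sum>u\<in>U. r u ^ 3) \<ge> 6 * s\<^sup>2" using main split rest sum_p const by linarith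
  assume "(\<Sum>u\<in>U. r u ^ 3) = 6 * s\<^sup>2"
  then have "(\<Sum>u\<in>U - insert e C. p (r u)) = 0" using main split rest sum_p const by linarith
  then have zero: "p (r u) = 0" if "u \<in> U - insert e C" for u
    using that U p_nonneg by (subst (asm) sum_nonneg_eq_0_iff) auto
  have "r u = 0" if "u \<in> U - insert e C" for u
  proof -
    have "(r u)\<^sup>2 * (r u + \<sigma>) = 0" using zero[OF that]
      by (simp add: p_def power2_eq_square power3_eq_cube algebra_simps)
    moreover have "r u + \<sigma> > 0" using lower[of u] that \<sigma> by auto
    ultimately show ?thesis by simp
  qed
  then have "{u \<in> U. r u \<noteq> 0} \<subseteq> insert e C" by blast
  then have "card {u \<in> U. r u \<noteq> 0} \<le> card (insert e C)" using C by (intro card_mono) auto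
  then show "card {u \<in> U. r u \<noteq> 0} \<le> 4" using C eC by simp
qed

section \<open>The top eigenvalue in the absence of 4-cliques\<close>

context symmetric_kernel
begin

text \<open>
  For a 0-1 kernel, \<open>(1 - a w u) * (1 - a w v) \<ge> 0\<close> bounds the number of neighbours of \<open>w\<close> on an edge by
  1 plus the indicator of a triangle; the hypothesis \<open>free\<close> bounds the number of neighbours on a
  triangle by 2. Both are summed with weight \<open>x w\<close>, where the eigenvalue equation turns neighbour sums
  into \<open>c * x\<close>. The total \<open>R\<close> of the weights of triangle vertices is then eliminated. The sums
  run over ordered pairs and triples, so for a graph they are \<open>2 m\<close> and \<open>6 t\<close>.
\<close>

lemma top_eigenvalue_cube_le:
  assumes bin: "\<And>v w. a v w = 0 \<or> a v w = 1"
    and free: "\<And>u v z w. u \<in> V \<Longrightarrow> v \<in> V \<Longrightarrow> z \<in> V \<Longrightarrow> w \<in> V \<Longrightarrow>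
      a u v * a v z * a z u * (a w u + a w v + a w z) \<le> a u v * a v z * a z u * 2"
    and x: "\<And>v. 0 \<le> x v" "v0 \<in> V" "x v0 \<noteq> 0"
    and eig: "\<And>v. v \<in> V \<Longrightarrow> (\<Sum>w\<in>V. a v w * x w) = c * x v" and c: "0 \<le> c"
  shows "3 * c ^ 3 \<le> 3/2 * c * (\<Sum>v\<in>V. \<Sum>w\<in>V. a v w)
     + (\<Sum>u\<in>V. \<Sum>v\<in>V. \<Sum>z\<in>V. a u v * a v z * a z u)"
proof -
  define S where "S = (\<Sum>v\<in>V. x v)"
  have "S > 0"
    unfolding S_def using finite_V x by (intro sum_pos2[of _ v0]) (auto simp: less_le)
  define M where "M = (\<Sum>v\<in>V. \<Sum>w\<in>V. a v w)"
  define t where "t u v z = a u v * a v z * a z u" for u v z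
  define T where "T = (\<Sum>u\<in>V. \<Sum>v\<in>V. \<Sum>z\<in>V. t u v z)"
  define R where "R = (\<Sum>u\<in>V. \<Sum>v\<in>V. \<Sum>z\<in>V. t u v z * x z)"
  have eig': "(\<Sum>w\<in>V. x w * a w v) = c * x v" if "v \<in> V" for v
    using eig[OF that] by (simp add: a_sym mult.commute)
  have cyc: "(\<Sum>u\<in>V. \<Sum>v\<in>V. \<Sum>z\<in>V. F u v z) = (\<Sum>u\<in>V. \<Sum>v\<in>V. \<Sum>z\<in>V. F v z u)"
    for F :: "'a \<Rightarrow> 'a \<Rightarrow> 'a \<Rightarrow> real"
  proof -
    have "(\<Sum>u\<in>V. \<Sum>v\<in>V. \<Sum>z\<in>V. F u v z) = (\<Sum>u\<in>V. \<Sum>z\<in>V. \<Sum>v\<in>V. F u v z)"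
      by (intro sum.cong refl sum.swap)
    also have "\<dots> = (\<Sum>z\<in>V. \<Sum>u\<in>V. \<Sum>v\<in>V. F u v z)" by (rule sum.swap)
    finally show ?thesis .
  qed
  have step1: "2 * c\<^sup>2 * S \<le> M * S + R"
  proof -
    have L: "(\<Sum>u\<in>V. \<Sum>v\<in>V. \<Sum>w\<in>V. a u v * (x w * (a w u + a w v))) = 2 * c\<^sup>2 * S"
    proof -
      have "(\<Sum>u\<in>V. \<Sum>v\<in>V. \<Sum>w\<in>V. a u v * (x w * (a w u + a w v)))
          = (\<Sum>u\<in>V. \<Sum>v\<in>V. a u v * (c * x u + c * x v))"
        by (intro sum.cong refl) (simp add: sum_distrib_left[symmetric] distrib_left sum.distrib eig')
      also have "\<dots> = c * (\<Sum>u\<in>V. \<Sum>v\<in>V. a u v * x u) + c * (\<Sum>u\<in>V. \<Sum>v\<in>V. a u v * x v)"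
        by (simp add: distrib_left sum.distrib sum_distrib_left mult_ac)
      also have "(\<Sum>u\<in>V. \<Sum>v\<in>V. a u v * x u) = (\<Sum>u\<in>V. \<Sum>v\<in>V. a u v * x v)"
        by (subst sum.swap) (simp add: a_sym)
      also have "(\<Sum>u\<in>V. \<Sum>v\<in>V. a u v * x v) = c * S"
        by (simp add: eig S_def sum_distrib_left)
      finally show ?thesis by (simp add: power2_eq_square)
    qed
    have "(\<Sum>u\<in>V. \<Sum>v\<in>V. \<Sum>w\<in>V. a u v * (x w * (a w u + a w v)))
       \<le> (\<Sum>u\<in>V. \<Sum>v\<in>V. \<Sum>w\<in>V. a u v * x w + t u v w * x w)"
    proof (intro sum_mono)
      fix u v w
      have "a w u + a w v \<le> 1 + a w u * a w v" using bin[of w u] bin[of w v] by auto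
      then have "a u v * x w * (a w u + a w v) \<le> a u v * x w * (1 + a w u * a w v)"
        using x(1)[of w] bin[of u v] by (intro mult_left_mono) auto
      then show "a u v * (x w * (a w u + a w v)) \<le> a u v * x w + t u v w * x w"
        by (simp add: t_def a_sym[of v w] algebra_simps)
    qed
    also have "\<dots> = (\<Sum>u\<in>V. \<Sum>v\<in>V. a u v * S) + R"
      by (simp add: sum.distrib R_def S_def sum_distrib_left)
    also have "(\<Sum>u\<in>V. \<Sum>v\<in>V. a u v * S) = M * S" by (simp add: M_def sum_distrib_right)
    finally show ?thesis using L by simp
  qed
  have t_cyc: "t v z u = t u v z" for u v z by (simp add: t_def)
  have Rv: "(\<Sum>u\<in>V. \<Sum>v\<in>V. \<Sum>z\<in>V. t u v z * x v) = R"
    unfolding R_def by (subst cyc) (simp add: t_cyc)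
  have Ru: "(\<Sum>u\<in>V. \<Sum>v\<in>V. \<Sum>z\<in>V. t u v z * x u) = R"
    unfolding Rv[symmetric] by (subst cyc) (simp add: t_cyc)
  have step2: "3 * c * R \<le> 2 * S * T"
  proof -
    have "(\<Sum>u\<in>V. \<Sum>v\<in>V. \<Sum>z\<in>V. \<Sum>w\<in>V. t u v z * (a w u + a w v + a w z) * x w)
       \<le> (\<Sum>u\<in>V. \<Sum>v\<in>V. \<Sum>z\<in>V. \<Sum>w\<in>V. t u v z * 2 * x w)"
      using free x(1) by (intro sum_mono mult_right_mono) (auto simp: t_def)
    also have "\<dots> = 2 * S * T"
      by (simp add: T_def S_def sum_distrib_left[symmetric] sum_distrib_right[symmetric])
    also have "(\<Sum>u\<in>V. \<Sum>v\<in>V. \<Sum>z\<in>V. \<Sum>w\<in>V. t u v z * (a w u + a w v + a w z) * x w)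
        = (\<Sum>u\<in>V. \<Sum>v\<in>V. \<Sum>z\<in>V. t u v z * (c * x u + c * x v + c * x z))"
    proof (intro sum.cong refl)
      fix u v z assume "u \<in> V" "v \<in> V" "z \<in> V"
      have "(\<Sum>w\<in>V. t u v z * (a w u + a w v + a w z) * x w)
        = t u v z * ((\<Sum>w\<in>V. x w * a w u) + (\<Sum>w\<in>V. x w * a w v) + (\<Sum>w\<in>V. x w * a w z))"
        by (simp add: sum_distrib_left sum.distrib[symmetric] algebra_simps)
      then show "(\<Sum>w\<in>V. t u v z * (a w u + a w v + a w z) * x w)
        = t u v z * (c * x u + c * x v + c * x z)"
        using \<open>u \<in> V\<close> \<open>v \<in> V\<close> \<open>z \<in> V\<close> by (simp add: eig')
    qed
    also have "\<dots> = c * (\<Sum>u\<in>V. \<Sum>v\<in>V. \<Sum>z\<in>V. t u v z * x u)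
        + c * (\<Sum>u\<in>V. \<Sum>v\<in>V. \<Sum>z\<in>V. t u v z * x v) + c * R"
      by (simp add: distrib_left sum.distrib sum_distrib_left R_def mult_ac)
    also have "(\<Sum>u\<in>V. \<Sum>v\<in>V. \<Sum>z\<in>V. t u v z * x v) = R" by (rule Rv)
    also have "(\<Sum>u\<in>V. \<Sum>v\<in>V. \<Sum>z\<in>V. t u v z * x u) = R" by (rule Ru)
    finally show ?thesis by (simp add: mult_ac)
  qed
  have "3 * c * (2 * c\<^sup>2 * S) \<le> 3 * c * (M * S + R)" using step1 c by (intro mult_left_mono) auto
  with step2 have "S * (6 * c ^ 3) \<le> S * (3 * c * M + 2 * T)"
    by (simp add: power2_eq_square power3_eq_cube algebra_simps)
  then have "6 * c ^ 3 \<le> 3 * c * M + 2 * T" using \<open>S > 0\<close> by simp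
  then show ?thesis by (simp add: M_def T_def t_def)
qed

end

section \<open>Adjacency kernels of graphs\<close>

definition adj :: "'a pair_pre_digraph \<Rightarrow> 'a \<Rightarrow> 'a \<Rightarrow> real" where
  "adj G u v = (if (u, v) \<in> parcs G then 1 else 0)"

lemma parcs_sym: "pair_graph G \<Longrightarrow> (u, v) \<in> parcs G \<longleftrightarrow> (v, u) \<in> parcs G"
  using pair_sym_digraph.pair_sym_arcs[of G]
  by (auto simp: pair_graph_def pair_pseudo_graph_def symmetric_def dest: symD)

lemma parcs_irrefl: "pair_graph G \<Longrightarrow> (u, u) \<notin> parcs G"
  using pair_loopfree_digraph.pair_no_loops[of G "(u, u)"]
  by (auto simp: pair_graph_def pair_digraph_def)

lemma parcs_verts: "pair_graph G \<Longrightarrow> (u, v) \<in> parcs G \<Longrightarrow> u \<in> pverts G \<and> v \<in> pverts G"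
  using pair_wf_digraph.wellformed'[of G u v]
  by (auto simp: pair_graph_def pair_digraph_def pair_fin_digraph_def)

lemma finite_pverts: "pair_graph G \<Longrightarrow> finite (pverts G)"
  by (auto simp: pair_graph_def pair_digraph_def dest: pair_fin_digraph.pair_finite_verts)

lemma finite_parcs: "pair_graph G \<Longrightarrow> finite (parcs G)"
  by (auto simp: pair_graph_def pair_digraph_def dest: pair_fin_digraph.pair_finite_arcs)

lemma symmetric_kernel_adj:
  assumes G: "pair_graph G"
  shows "symmetric_kernel (pverts G) (adj G)"
proof
  show "finite (pverts G)" by (rule finite_pverts[OF G])
  show "adj G v w = adj G w v" for v w
    by (simp only: adj_def parcs_sym[OF G, of v w])
qed

lemma card_constant_fibres:
  assumes "finite S" "\<And>y. y \<in> f ` S \<Longrightarrow> card {x \<in> S. f x = y} = k"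
  shows "card S = k * card (f ` S)"
proof -
  have "card S = (\<Sum>x\<in>S. 1)" by simp
  also have "\<dots> = (\<Sum>y\<in>f ` S. \<Sum>x\<in>{x \<in> S. f x = y}. 1)" by (rule sum.image_gen[OF assms(1)])
  also have "\<dots> = (\<Sum>y\<in>f ` S. k)" using assms(2) by (intro sum.cong) auto
  finally show ?thesis by simp
qed

lemma card_parcs:
  assumes G: "pair_graph G"
  shows "card (parcs G) = 2 * card (edges G)"
proof -
  have img: "edges G = (\<lambda>(u, v). {u, v}) ` parcs G" by (auto simp: edges_def)
  show ?thesis
    unfolding img
  proof (rule card_constant_fibres[OF finite_parcs[OF G]])
    fix y assume "y \<in> (\<lambda>(u, v). {u, v}) ` parcs G"
    then obtain u v where uv: "(u, v) \<in> parcs G" "y = {u, v}" by auto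
    then have "{x \<in> parcs G. (\<lambda>(u, v). {u, v}) x = y} = {(u, v), (v, u)}"
      using parcs_sym[OF G] by (auto simp: doubleton_eq_iff)
    moreover have "u \<noteq> v" using uv parcs_irrefl[OF G] by auto
    ultimately show "card {x \<in> parcs G. (\<lambda>(u, v). {u, v}) x = y} = 2" by simp
  qed
qed

lemma finite_edges: "pair_graph G \<Longrightarrow> finite (edges G)"
proof -
  assume "pair_graph G"
  moreover have "edges G = (\<lambda>(u, v). {u, v}) ` parcs G" by (auto simp: edges_def)
  ultimately show ?thesis by (simp add: finite_parcs)
qed

lemma sum_adj:
  assumes G: "pair_graph G"
  shows "(\<Sum>v\<in>pverts G. \<Sum>w\<in>pverts G. adj G v w) = 2 * real (card (edges G))"
proof -
  have "(\<Sum>v\<in>pverts G. \<Sum>w\<in>pverts G. adj G v w)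
      = (\<Sum>x\<in>pverts G \<times> pverts G. if x \<in> parcs G then 1 else 0)"
    by (simp add: sum.cartesian_product adj_def case_prod_beta)
  also have "\<dots> = real (card (parcs G))"
    using parcs_verts[OF G] finite_pverts[OF G]
    by (subst sum.inter_filter[symmetric]) (auto intro!: arg_cong[where f = card])
  finally show ?thesis by (simp add: card_parcs[OF G])
qed

lemma sum_adj_triangles:
  assumes G: "pair_graph G"
  shows "(\<Sum>u\<in>pverts G. \<Sum>v\<in>pverts G. \<Sum>w\<in>pverts G. adj G u v * adj G v w * adj G w u)
    = 6 * real (card (triangles G))"
proof -
  let ?V = "pverts G"
  define S where "S = {(u, v, w). (u, v) \<in> parcs G \<and> (v, w) \<in> parcs G \<and> (w, u) \<in> parcs G}"
  have sub: "S \<subseteq> ?V \<times> ?V \<times> ?V" using parcs_verts[OF G] by (auto simp: S_def)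
  then have fin: "finite S" using finite_pverts[OF G] finite_subset by blast
  note sym = parcs_sym[OF G] and irr = parcs_irrefl[OF G]
  let ?f = "\<lambda>(u, v, w). {u, v, w}"
  have img: "triangles G = ?f ` S"
  proof
    show "?f ` S \<subseteq> triangles G"
    proof clarify
      fix u v w assume "(u, v, w) \<in> S"
      then have "(u, v) \<in> parcs G" "(v, w) \<in> parcs G" "(w, u) \<in> parcs G" by (auto simp: S_def)
      moreover from this have "u \<noteq> v" "v \<noteq> w" "w \<noteq> u" using irr by auto
      ultimately show "{u, v, w} \<in> triangles G"
        using sym parcs_verts[OF G] by (auto simp: triangles_def)
    qed
    show "triangles G \<subseteq> ?f ` S"
    proof
      fix T assume T: "T \<in> triangles G"
      then obtain u v w where uvw: "T = {u, v, w}" "u \<noteq> v" "v \<noteq> w" "u \<noteq> w"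
        by (auto simp: triangles_def card_3_iff)
      then have "(u, v, w) \<in> S" using T by (auto simp: triangles_def S_def)
      then show "T \<in> ?f ` S" using uvw by force
    qed
  qed
  have "(\<Sum>u\<in>?V. \<Sum>v\<in>?V. \<Sum>w\<in>?V. adj G u v * adj G v w * adj G w u)
      = (\<Sum>x\<in>?V \<times> ?V \<times> ?V. if x \<in> S then 1 else 0)"
    by (simp add: sum.cartesian_product adj_def case_prod_beta S_def)
      (intro sum.cong refl, auto)
  also have "\<dots> = real (card S)"
    using sub finite_pverts[OF G]
    by (subst sum.inter_filter[symmetric]) (auto intro!: arg_cong[where f = card])
  also have "card S = 6 * card (?f ` S)"
  proof (rule card_constant_fibres[OF fin])
    fix y assume "y \<in> ?f ` S"
    then obtain u v w where uvw: "(u, v, w) \<in> S" "y = {u, v, w}" by auto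
    then have ne: "u \<noteq> v" "v \<noteq> w" "w \<noteq> u" using irr by (auto simp: S_def)
    have "{x \<in> S. ?f x = y} = {(u,v,w), (u,w,v), (v,u,w), (v,w,u), (w,u,v), (w,v,u)}"
    proof
      show "{x \<in> S. ?f x = y} \<subseteq> {(u,v,w), (u,w,v), (v,u,w), (v,w,u), (w,u,v), (w,v,u)}"
      proof
        fix x assume x: "x \<in> {x \<in> S. ?f x = y}"
        obtain u' v' w' where x': "x = (u', v', w')" by (cases x) auto
        have ne': "u' \<noteq> v'" "v' \<noteq> w'" "w' \<noteq> u'" using x x' irr by (auto simp: S_def)
        have "{u', v', w'} = {u, v, w}" using x x' uvw(2) by simp
        then have "u' \<in> {u, v, w}" "v' \<in> {u, v, w}" "w' \<in> {u, v, w}" by blast+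
        then show "x \<in> {(u,v,w), (u,w,v), (v,u,w), (v,w,u), (w,u,v), (w,v,u)}"
          using ne' unfolding x' by auto
      qed
      show "{(u,v,w), (u,w,v), (v,u,w), (v,w,u), (w,u,v), (w,v,u)} \<subseteq> {x \<in> S. ?f x = y}"
        using uvw sym by (auto simp: S_def)
    qed
    then show "card {x \<in> S. ?f x = y} = 6" using ne by simp
  qed
  finally show ?thesis by (simp add: img)
qed

text \<open>
  The maximum in the definition of the largest eigenvalue is attained and equals the maximum of the
  Rayleigh quotient.
\<close>

lemma largest_eigenvalue_eigenvector:
  assumes G: "pair_graph G" and "pverts G \<noteq> {}"
  shows "\<exists>x\<in>symmetric_kernel.supported (pverts G). (\<forall>v. 0 \<le> x v) \<and> (\<exists>v. x v \<noteq> 0) \<and>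
    symmetric_kernel.act (pverts G) (adj G) x = (\<lambda>v. largest_eigenvalue G * x v)"
proof -
  interpret symmetric_kernel "pverts G" "adj G" using symmetric_kernel_adj[OF G] .
  let ?V = "pverts G"
  have nonneg: "0 \<le> adj G v w" for v w by (simp add: adj_def)
  obtain x where x: "x \<in> supported" "\<And>v. 0 \<le> x v" "ip x x = 1" "act x = (\<lambda>v. rayleigh x * x v)"
    "\<And>f. f \<in> supported \<Longrightarrow> rayleigh f \<le> rayleigh x * ip f f"
    using nonnegative_top_eigenvector[OF nonneg assms(2)] by blast
  have x0: "\<exists>v\<in>?V. x v \<noteq> 0"
  proof (rule ccontr)
    assume "\<not> ?thesis"
    then have "ip x x = 0" by (simp add: ip_def)
    then show False using x(3) by simp
  qed
  obtain U where U: "eigenbasis U" using ex_eigenbasis by blast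
  let ?E = "{c. eigenvalue (adjacency_matrix G (vertex_order G)) c}"
  have mem: "c \<in> ?E \<longleftrightarrow> (\<exists>f. (\<exists>u\<in>?V. f u \<noteq> 0) \<and> (\<forall>u\<in>?V. (\<Sum>w\<in>?V. adj G u w * f w) = c * f u))" for c
  proof -
    note order = vertex_order[OF finite_pverts[OF G]]
    have eq: "(\<Sum>w\<in>?V. adj G u w * f w) = (\<Sum>w\<in>?V. if (u, w) \<in> parcs G then f w else 0)" for u f
      by (rule sum.cong) (auto simp: adj_def)
    show ?thesis
      unfolding mem_Collect_eq eigenvalue_adjacency_matrix_iff[OF order(1)] order(2) eq ..
  qed
  have ev: "\<exists>f\<in>supported. (\<exists>v. f v \<noteq> 0) \<and> act f = (\<lambda>v. c * f v)" if "c \<in> ?E" for c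
  proof -
    from mem[THEN iffD1, OF that] obtain f where "(\<exists>u\<in>?V. f u \<noteq> 0) \<and>
        (\<forall>u\<in>?V. (\<Sum>w\<in>?V. adj G u w * f w) = c * f u)"
      by (rule exE)
    then have f: "\<exists>u\<in>?V. f u \<noteq> 0" "\<And>u. u \<in> ?V \<Longrightarrow> (\<Sum>w\<in>?V. adj G u w * f w) = c * f u"
      by auto
    define g where "g = (\<lambda>v. if v \<in> ?V then f v else 0)"
    have "(\<Sum>w\<in>?V. adj G u w * g w) = (\<Sum>w\<in>?V. adj G u w * f w)" for u
      by (rule sum.cong) (auto simp: g_def)
    then have "act g = (\<lambda>v. c * g v)" using f(2) by (auto simp: act_def g_def)
    moreover have "g \<in> supported" "\<exists>v. g v \<noteq> 0" using f(1) by (auto simp: supported_def g_def)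
    ultimately show ?thesis by blast
  qed
  have "?E \<subseteq> rayleigh ` U"
  proof
    fix c assume "c \<in> ?E"
    from ev[OF this] obtain f v where "f \<in> supported" "f v \<noteq> 0" "act f = (\<lambda>v. c * f v)" by blast
    then show "c \<in> rayleigh ` U" using eigenvalue_in_basis[OF U] by blast
  qed
  then have "finite ?E" using eigenbasisD(1)[OF U] finite_subset by blast
  moreover have "rayleigh x \<in> ?E"
  proof -
    have "(\<Sum>w\<in>?V. adj G u w * x w) = rayleigh x * x u" if "u \<in> ?V" for u
      using fun_cong[OF x(4), of u] that by (simp add: act_def)
    then have "(\<exists>u\<in>?V. x u \<noteq> 0) \<and> (\<forall>u\<in>?V. (\<Sum>w\<in>?V. adj G u w * x w) = rayleigh x * x u)"
      using x0 by blast
    then show ?thesis unfolding mem by (rule exI[of _ x])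
  qed
  moreover have "c \<le> rayleigh x" if c: "c \<in> ?E" for c
  proof -
    obtain f v where f: "f \<in> supported" "f v \<noteq> 0" "act f = (\<lambda>v. c * f v)" using ev[OF c] by blast
    have "c * ip f f \<le> rayleigh x * ip f f" using x(5)[OF f(1)] by (simp add: rayleigh_def f(3) ip_scale)
    moreover have "ip f f \<noteq> 0" using ip_self_eq_0[OF f(1), of v] f(2) by blast
    then have "ip f f > 0" using ip_nonneg[of f] by simp
    ultimately show ?thesis by simp
  qed
  ultimately have "largest_eigenvalue G = rayleigh x"
    unfolding largest_eigenvalue_def by (intro Max_eqI) auto
  then show ?thesis using x(1,2,4) x0 by metis
qed

section \<open>Joins of a triangle with an independent set\<close>

text \<open>
  The extremal graph on the vertices of \<open>G\<close> themselves. Only arcs are constrained, so isolated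
  vertices outside \<open>T \<union> P\<close> are allowed.
\<close>

definition triangle_join :: "'a pair_pre_digraph \<Rightarrow> 'a set \<Rightarrow> 'a set \<Rightarrow> bool" where
  "triangle_join G T P \<longleftrightarrow> card T = 3 \<and> finite P \<and> T \<inter> P = {} \<and>
     parcs G = {(u, v). u \<in> T \<union> P \<and> v \<in> T \<union> P \<and> u \<noteq> v \<and> (u \<in> T \<or> v \<in> T)}"

lemma triangle_joinD:
  assumes "triangle_join G T P"
  shows "card T = 3" "finite T" "finite P" "T \<inter> P = {}"
    "(u, v) \<in> parcs G \<longleftrightarrow> u \<in> T \<union> P \<and> v \<in> T \<union> P \<and> u \<noteq> v \<and> (u \<in> T \<or> v \<in> T)"
  using assms by (auto simp: triangle_join_def card_ge_0_finite)

lemma nonisolated_triangle_join: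
  assumes J: "triangle_join G T P"
  shows "(\<exists>u. (v, u) \<in> parcs G) \<longleftrightarrow> v \<in> T \<union> P"
proof
  note D = triangle_joinD[OF J]
  assume v: "v \<in> T \<union> P"
  have "\<not> T \<subseteq> {v}"
  proof
    assume "T \<subseteq> {v}"
    then have "card T \<le> card {v}" by (intro card_mono) auto
    then show False using D(1) by simp
  qed
  then obtain u where "u \<in> T" "u \<noteq> v" by blast
  then show "\<exists>u. (v, u) \<in> parcs G" using v D(5) by blast
qed (use triangle_joinD(5)[OF J] in auto)

lemma card_edges_triangle_join:
  assumes G: "pair_graph G" and J: "triangle_join G T P"
  shows "card (edges G) = 3 * card P + 3"
proof -
  note D = triangle_joinD[OF J]
  define D' where "D' = P \<times> P \<union> (\<lambda>u. (u, u)) ` T"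
  have "parcs G = (T \<union> P) \<times> (T \<union> P) - D'"
    using D(4,5) by (auto simp: D'_def)
  moreover have "card D' = card P * card P + 3"
    unfolding D'_def using D by (subst card_Un_disjoint)
      (auto simp: card_cartesian_product card_image inj_on_def)
  moreover have "card ((T \<union> P) \<times> (T \<union> P)) = (3 + card P) * (3 + card P)"
    using D by (simp add: card_cartesian_product card_Un_disjoint)
  moreover have "D' \<subseteq> (T \<union> P) \<times> (T \<union> P)" "finite D'"
    using D by (auto simp: D'_def)
  ultimately have "card (parcs G) = (3 + card P) * (3 + card P) - (card P * card P + 3)"
    by (simp add: card_Diff_subset)
  also have "\<dots> = 6 * card P + 6" by (simp add: algebra_simps)
  finally show ?thesis using card_parcs[OF G] by simp
qed

text \<open>
  Every triangle other than \<open>T\<close> consists of one vertex of the independent set \<open>P\<close> and two of \<open>T\<close>.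
\<close>

lemma card_triangles_triangle_join:
  assumes G: "pair_graph G" and J: "triangle_join G T P"
  shows "card (triangles G) = 3 * card P + 1"
proof -
  note D = triangle_joinD[OF J]
  let ?f = "\<lambda>(k, p). insert p (T - {k})"
  have TP: "T \<union> P \<subseteq> pverts G"
    using nonisolated_triangle_join[OF J] parcs_verts[OF G] by blast
  have "triangles G = insert T (?f ` (T \<times> P))"
  proof
    show "triangles G \<subseteq> insert T (?f ` (T \<times> P))"
    proof
      fix X assume "X \<in> triangles G"
      then have X: "card X = 3" "\<And>u v. u \<in> X \<Longrightarrow> v \<in> X \<Longrightarrow> u \<noteq> v \<Longrightarrow> (u, v) \<in> parcs G"
        by (auto simp: triangles_def)
      then have finX: "finite X" by (simp add: card_ge_0_finite)
      have XTP: "X \<subseteq> T \<union> P"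
      proof
        fix u assume u: "u \<in> X"
        have "\<not> X \<subseteq> {u}" using X(1) card_mono[of "{u}" X] by auto
        then show "u \<in> T \<union> P" using X(2)[OF u] D(5) by blast
      qed
      show "X \<in> insert T (?f ` (T \<times> P))"
      proof (cases "X \<subseteq> T")
        case True
        then have "X = T" using X(1) D(1,2) by (simp add: card_subset_eq)
        then show ?thesis by simp
      next
        case False
        then obtain p where p: "p \<in> X" "p \<in> P" "p \<notin> T" using XTP by blast
        have sub: "X - {p} \<subseteq> T"
        proof
          fix u assume "u \<in> X - {p}"
          then have "(u, p) \<in> parcs G" using X(2) p by blast
          then show "u \<in> T" using p D(5) by blast
        qed
        have "card (T - (X - {p})) = 1"
          using sub X(1) finX p D(1) by (simp add: card_Diff_subset)
        then obtain k where k: "T - (X - {p}) = {k}" by (auto simp: card_1_singleton_iff)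
        then have "X = insert p (T - {k})" "k \<in> T" using sub p by blast+
        then show ?thesis using p by force
      qed
    qed
    show "insert T (?f ` (T \<times> P)) \<subseteq> triangles G"
    proof -
      have "T \<in> triangles G" using D(1,5) TP by (auto simp: triangles_def)
      moreover have "insert p (T - {k}) \<in> triangles G" if "k \<in> T" "p \<in> P" for k p
      proof -
        have "p \<notin> T" using that D(4) by blast
        then have "card (insert p (T - {k})) = 3" using D(1,2) that by simp
        then show ?thesis using D(5) TP that by (auto simp: triangles_def)
      qed
      ultimately show ?thesis by auto
    qed
  qed
  moreover have "T \<notin> ?f ` (T \<times> P)" using D(4) by auto
  moreover have "inj_on ?f (T \<times> P)"
  proof (rule inj_onI, clarify)
    fix k p k' p' assume *: "k \<in> T" "p \<in> P" "k' \<in> T" "p' \<in> P"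
      "insert p (T - {k}) = insert p' (T - {k'})"
    have p: "p \<notin> T" "p' \<notin> T" using * D(4) by auto
    have "p = p'" using *(5) p by blast
    moreover have "k \<notin> insert p (T - {k})" using *(1) p by auto
    then have "k = k'" using *(1,5) by blast
    ultimately show "k = k' \<and> p = p'" by simp
  qed
  ultimately show ?thesis
    using D by (simp add: card_image card_cartesian_product)
qed

text \<open>
  On both sides an arc is the pair of its ends, so the arc map of the isomorphism is the vertex map
  applied to both components. The sets \<open>T\<close> and \<open>P\<close> are the preimages of the two summands.
\<close>

lemma join_iso_imp_triangle_join:
  assumes G: "pair_graph G"
    and iso: "digraph_iso (with_proj (delete_isolated G))
      (with_proj (graph_join (complete_graph 3) (empty_graph n)))"
  shows "\<exists>T P. triangle_join G T P \<and> card P = n"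
proof -
  let ?H = "graph_join (complete_graph 3) (empty_graph n)"
  obtain f where f: "pre_digraph.digraph_isomorphism (with_proj (delete_isolated G)) f"
    and H: "with_proj ?H = app_iso f (with_proj (delete_isolated G))"
    using iso by (auto simp: digraph_iso_def)
  define h where "h = iso_verts f"
  define W where "W = pverts (delete_isolated G)"
  have inj: "inj_on h W"
    using f by (simp add: pre_digraph.digraph_isomorphism_def h_def W_def)
  have HV: "pverts ?H = h ` W"
    using arg_cong[OF H, of verts] by (simp add: h_def W_def)
  have arcs: "parcs ?H = iso_arcs f ` parcs G"
    using arg_cong[OF H, of arcs] by (simp add: delete_isolated_def)
  have ends: "iso_tail f = fst" "iso_head f = snd"
    using arg_cong[OF H, of tail] arg_cong[OF H, of head] by simp_all
  have "iso_arcs f (u, v) = (h u, h v)" if "(u, v) \<in> parcs G" for u v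
    using f that ends by (auto simp: pre_digraph.digraph_isomorphism_def h_def delete_isolated_def
        intro!: prod_eqI)
  then have HA: "parcs ?H = (\<lambda>(u, v). (h u, h v)) ` parcs G"
    unfolding arcs by (intro image_cong) auto
  have GW: "u \<in> W \<and> v \<in> W" if "(u, v) \<in> parcs G" for u v
    using that parcs_sym[OF G] parcs_verts[OF G] by (auto simp: W_def delete_isolated_def)
  have arc_iff: "(u, v) \<in> parcs G \<longleftrightarrow> (h u, h v) \<in> parcs ?H" if "u \<in> W" "v \<in> W" for u v
  proof
    assume "(h u, h v) \<in> parcs ?H"
    then obtain u' v' where "(u', v') \<in> parcs G" "h u = h u'" "h v = h v'"
      unfolding HA by auto
    moreover from this have "u = u'" "v = v'" using that GW inj_onD[OF inj] by blast+
    ultimately show "(u, v) \<in> parcs G" by simp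
  qed (auto simp: HA)
  define T where "T = {v \<in> W. h v \<in> range Inl}"
  define P where "P = {v \<in> W. h v \<in> range Inr}"
  have W: "W = T \<union> P" by (auto simp: T_def P_def) (metis obj_sumE rangeI)
  have HV': "h ` W = Inl ` {..<3} \<union> Inr ` {..<n}"
    unfolding HV[symmetric] by (auto simp: graph_join_def complete_graph_def empty_graph_def)
  have "h ` T = h ` W \<inter> range Inl" by (auto simp: T_def)
  then have "h ` T = Inl ` {..<3}" unfolding HV' by auto
  then have cT: "card T = 3"
    using card_image[of h T] inj_on_subset[OF inj, of T] by (auto simp: T_def card_image)
  have "h ` P = h ` W \<inter> range Inr" by (auto simp: P_def)
  then have "h ` P = Inr ` {..<n}" unfolding HV' by auto
  then have cP: "card P = n"
    using card_image[of h P] inj_on_subset[OF inj, of P] by (auto simp: P_def card_image)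
  have "finite P" using finite_pverts[OF G] by (simp add: P_def W_def delete_isolated_def)
  moreover have "T \<inter> P = {}" by (auto simp: T_def P_def)
  moreover have "(u, v) \<in> parcs G \<longleftrightarrow> u \<noteq> v \<and> (u \<in> T \<or> v \<in> T)" if uv: "u \<in> W" "v \<in> W" for u v
  proof -
    have "h u \<in> pverts ?H" "h v \<in> pverts ?H" using uv HV by auto
    then have "(h u, h v) \<in> parcs ?H \<longleftrightarrow> h u \<noteq> h v \<and> (h u \<in> range Inl \<or> h v \<in> range Inl)"
      by (auto simp: graph_join_def complete_graph_def empty_graph_def)
    then show ?thesis using uv arc_iff inj by (auto simp: T_def dest: inj_onD)
  qed
  then have "parcs G = {(u, v). u \<in> T \<union> P \<and> v \<in> T \<union> P \<and> u \<noteq> v \<and> (u \<in> T \<or> v \<in> T)}"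
    unfolding W[symmetric] using GW by blast
  ultimately have "triangle_join G T P" using cT by (simp add: triangle_join_def)
  then show ?thesis using cP by blast
qed

lemma triangle_join_imp_join_iso:
  assumes G: "pair_graph G" and J: "triangle_join G T P"
  shows "digraph_iso (with_proj (delete_isolated G))
      (with_proj (graph_join (complete_graph 3) (empty_graph (card P))))"
proof -
  note D = triangle_joinD[OF J]
  let ?H = "graph_join (complete_graph 3) (empty_graph (card P))"
  have W: "pverts (delete_isolated G) = T \<union> P"
    using nonisolated_triangle_join[OF J] parcs_verts[OF G] by (auto simp: delete_isolated_def)
  obtain f where f: "bij_betw f T {..<3::nat}"
    using ex_bij_betw_finite_nat[OF D(2)] D(1) by (auto simp: atLeast0LessThan)
  obtain g where g: "bij_betw g P {..<card P}"
    using ex_bij_betw_finite_nat[OF D(3)] by (auto simp: atLeast0LessThan)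
  define h where "h v = (if v \<in> T then Inl (f v) else Inr (g v))" for v
  have inj: "inj_on h (T \<union> P)"
    using f g by (auto simp: inj_on_def h_def bij_betw_def)
  have img: "h ` (T \<union> P) = Inl ` {..<3} \<union> Inr ` {..<card P}"
  proof -
    have "h ` T = Inl ` f ` T" by (auto simp: h_def image_image)
    moreover have "h ` P = Inr ` g ` P" using D(4) by (force simp: h_def image_image)
    ultimately show ?thesis using f g by (simp add: image_Un bij_betw_def)
  qed
  have side: "h v \<in> range Inl \<longleftrightarrow> v \<in> T" for v by (auto simp: h_def)
  have HA_iff: "(x, y) \<in> parcs ?H \<longleftrightarrow> x \<in> pverts ?H \<and> y \<in> pverts ?H \<and> x \<noteq> y \<and>
      (x \<in> range Inl \<or> y \<in> range Inl)" for x y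
    by (cases x; cases y) (auto simp: graph_join_def complete_graph_def empty_graph_def)
  have HV: "pverts ?H = h ` (T \<union> P)"
    unfolding img by (auto simp: graph_join_def complete_graph_def empty_graph_def)
  have HA: "parcs ?H = map_prod h h ` parcs G"
  proof
    show "map_prod h h ` parcs G \<subseteq> parcs ?H"
    proof
      fix e assume "e \<in> map_prod h h ` parcs G"
      then obtain u v where uv: "e = (h u, h v)" "(u, v) \<in> parcs G" by auto
      then have "u \<in> T \<union> P" "v \<in> T \<union> P" "u \<noteq> v" "u \<in> T \<or> v \<in> T" using D(5) by auto
      moreover from this have "h u \<noteq> h v" using inj_onD[OF inj] by blast
      ultimately show "e \<in> parcs ?H"
        unfolding uv(1) HA_iff HV side by blast
    qed
    show "parcs ?H \<subseteq> map_prod h h ` parcs G"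
    proof clarify
      fix x y assume xy: "(x, y) \<in> parcs ?H"
      then obtain u v where "x = h u" "y = h v" "u \<in> T \<union> P" "v \<in> T \<union> P"
        unfolding HA_iff HV by blast
      moreover from this xy have "(u, v) \<in> parcs G" using D(5) by (auto simp: HA_iff side)
      ultimately show "(x, y) \<in> map_prod h h ` parcs G" by force
    qed
  qed
  define \<Phi> where "\<Phi> = \<lparr>iso_verts = h, iso_arcs = map_prod h h, iso_head = snd, iso_tail = fst\<rparr>"
  have "inj_on (map_prod h h) (parcs G)"
    using inj D(5) by (auto simp: inj_on_def)
  moreover have "pair_wf_digraph (delete_isolated G)"
  proof -
    have "parcs (delete_isolated G) = parcs G" by (simp add: delete_isolated_def)
    then show ?thesis using D(5) by unfold_locales (auto simp: W)
  qed
  ultimately have "pre_digraph.digraph_isomorphism (with_proj (delete_isolated G)) \<Phi>"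
    using inj W
    by (auto simp: pre_digraph.digraph_isomorphism_def \<Phi>_def wf_digraph_wp_iff delete_isolated_def)
  moreover have "with_proj ?H = app_iso \<Phi> (with_proj (delete_isolated G))"
    using HV HA W by (simp add: with_proj_def app_iso_def \<Phi>_def delete_isolated_def)
  ultimately show ?thesis by (auto simp: digraph_iso_def)
qed

section \<open>Graphs without 4-cliques\<close>

text \<open>
  A triangle and a vertex adjacent to all three of its vertices would form a 4-clique.
\<close>

lemma largest_eigenvalue_cube_le:
  assumes G: "pair_graph G"
    and free: "\<not> (\<exists>K \<subseteq> pverts G. card K = 4 \<and> (\<forall>u\<in>K. \<forall>v\<in>K. u \<noteq> v \<longrightarrow> (u, v) \<in> parcs G))"
    and lam: "0 \<le> largest_eigenvalue G" and ne: "pverts G \<noteq> {}"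
  shows "largest_eigenvalue G ^ 3 \<le>
    real (card (edges G)) * largest_eigenvalue G + 2 * real (card (triangles G))"
proof -
  interpret symmetric_kernel "pverts G" "adj G" using symmetric_kernel_adj[OF G] .
  let ?l = "largest_eigenvalue G"
  obtain x v0 where x: "x \<in> supported" "\<forall>v. 0 \<le> x v" "x v0 \<noteq> 0" "act x = (\<lambda>v. ?l * x v)"
    using largest_eigenvalue_eigenvector[OF G ne] by (elim bexE conjE exE)
  have v0: "v0 \<in> pverts G" using x(1,3) by (auto simp: supported_def)
  note sym = parcs_sym[OF G] and irr = parcs_irrefl[OF G]
  have "3 * ?l ^ 3 \<le> 3/2 * ?l * (\<Sum>v\<in>pverts G. \<Sum>w\<in>pverts G. adj G v w)
     + (\<Sum>u\<in>pverts G. \<Sum>v\<in>pverts G. \<Sum>z\<in>pverts G. adj G u v * adj G v z * adj G z u)"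
  proof (rule top_eigenvalue_cube_le[where x = x, OF _ _ _ v0 x(3) _ lam])
    show "0 \<le> x v" for v using x(2) by blast
    show "adj G v w = 0 \<or> adj G v w = 1" for v w by (simp add: adj_def)
    show "(\<Sum>w\<in>pverts G. adj G v w * x w) = ?l * x v" if "v \<in> pverts G" for v
      using fun_cong[OF x(4), of v] that by (simp add: act_def)
    fix u v z w assume V: "u \<in> pverts G" "v \<in> pverts G" "z \<in> pverts G" "w \<in> pverts G"
    show "adj G u v * adj G v z * adj G z u * (adj G w u + adj G w v + adj G w z)
        \<le> adj G u v * adj G v z * adj G z u * 2"
    proof (rule ccontr)
      assume contr: "\<not> ?thesis"
      then have arcs: "(u, v) \<in> parcs G" "(v, z) \<in> parcs G" "(z, u) \<in> parcs G"
        "(w, u) \<in> parcs G" "(w, v) \<in> parcs G" "(w, z) \<in> parcs G"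
        by (auto simp: adj_def split: if_splits)
      then have "u \<noteq> v" "v \<noteq> z" "z \<noteq> u" "w \<noteq> u" "w \<noteq> v" "w \<noteq> z" using irr by auto
      then have "card {u, v, z, w} = 4" by auto
      moreover have "\<forall>a\<in>{u, v, z, w}. \<forall>b\<in>{u, v, z, w}. a \<noteq> b \<longrightarrow> (a, b) \<in> parcs G"
        using arcs sym by blast
      moreover have "{u, v, z, w} \<subseteq> pverts G" using V by simp
      ultimately show False using free by blast
    qed
  qed
  then show ?thesis
    unfolding sum_adj[OF G] sum_adj_triangles[OF G] by (simp add: algebra_simps)
qed

section \<open>Graphs with a 4-clique\<close>

lemma clique_edges:
  assumes K: "\<And>u v. u \<in> K \<Longrightarrow> v \<in> K \<Longrightarrow> u \<noteq> v \<Longrightarrow> (u, v) \<in> parcs G"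
  shows "{B. B \<subseteq> K \<and> card B = 2} \<subseteq> edges G"
proof
  fix B assume "B \<in> {B. B \<subseteq> K \<and> card B = 2}"
  then obtain u v where "B = {u, v}" "u \<in> K" "v \<in> K" "u \<noteq> v" by (auto simp: card_2_iff)
  then show "B \<in> edges G" using K unfolding edges_def by blast
qed

lemma sum_by_part:
  fixes g :: "'b \<Rightarrow> real"
  assumes "finite W" "finite K" "\<And>v. v \<in> W \<Longrightarrow> \<kappa> v \<in> K"
  shows "(\<Sum>v\<in>W. g (\<kappa> v)) = (\<Sum>i\<in>K. real (card {v \<in> W. \<kappa> v = i}) * g i)"
proof -
  have "(\<Sum>v\<in>W. g (\<kappa> v)) = (\<Sum>i\<in>K. \<Sum>v\<in>{v \<in> W. \<kappa> v = i}. g (\<kappa> v))"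
    using assms by (intro sum.group[symmetric]) auto
  also have "\<dots> = (\<Sum>i\<in>K. real (card {v \<in> W. \<kappa> v = i}) * g i)"
    by (intro sum.cong refl) simp
  finally show ?thesis .
qed

text \<open>
  For part sizes \<open>1 + \<alpha> i\<close> the difference \<open>t - (m - 2)\<close> is the sum of all products of two and of three
  different \<open>\<alpha> i\<close>: the constant and linear terms of the elementary symmetric polynomials cancel. It
  vanishes only if at most one \<open>\<alpha> i\<close> is nonzero. The map \<open>\<kappa>\<close> sends a vertex to the representative in
  \<open>K\<close> of its part.
\<close>

lemma triangle_join_if_complete_four_partite:
  assumes G: "pair_graph G" and K: "K \<subseteq> W" "card K = 4" and W: "finite W" "W \<subseteq> pverts G"
    and \<kappa>: "\<And>v. v \<in> W \<Longrightarrow> \<kappa> v \<in> K" "\<And>i. i \<in> K \<Longrightarrow> \<kappa> i = i"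
    and parcs: "\<And>u v. (u, v) \<in> parcs G \<longleftrightarrow> u \<in> W \<and> v \<in> W \<and> \<kappa> u \<noteq> \<kappa> v"
    and few: "card (triangles G) + 2 = card (edges G)"
  shows "\<exists>T P. triangle_join G T P"
proof -
  have finK: "finite K" using K by (simp add: card_ge_0_finite)
  define n where "n i = real (card {v \<in> W. \<kappa> v = i})" for i
  note parts = sum_by_part[of W K \<kappa>, OF W(1) finK \<kappa>(1), folded n_def]
  define g where "g i j = (if i = j then 0 else 1::real)" for i j :: 'a
  have restrict: "(\<Sum>v\<in>pverts G. f v) = (\<Sum>v\<in>W. f v)" if "\<And>v. v \<notin> W \<Longrightarrow> f v = 0" for f :: "'a \<Rightarrow> real"
    using W finite_pverts[OF G] that by (intro sum.mono_neutral_right) auto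
  have adj: "adj G u v = (if u \<in> W \<and> v \<in> W then g (\<kappa> u) (\<kappa> v) else 0)" for u v
    by (simp add: adj_def parcs g_def)
  have "2 * real (card (edges G)) = (\<Sum>v\<in>W. \<Sum>w\<in>W. g (\<kappa> v) (\<kappa> w))"
    unfolding sum_adj[OF G, symmetric] by (simp add: restrict adj)
  also have "\<dots> = (\<Sum>v\<in>W. (\<lambda>i. \<Sum>j\<in>K. n j * g i j) (\<kappa> v))"
    by (intro sum.cong refl parts)
  also have "\<dots> = (\<Sum>i\<in>K. n i * (\<Sum>j\<in>K. n j * g i j))" by (rule parts)
  finally have m: "2 * real (card (edges G)) = (\<Sum>i\<in>K. n i * (\<Sum>j\<in>K. n j * g i j))" .
  have "6 * real (card (triangles G))
      = (\<Sum>u\<in>W. \<Sum>v\<in>W. \<Sum>w\<in>W. g (\<kappa> u) (\<kappa> v) * g (\<kappa> v) (\<kappa> w) * g (\<kappa> w) (\<kappa> u))"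
    unfolding sum_adj_triangles[OF G, symmetric] by (simp add: restrict adj)
  also have "\<dots> = (\<Sum>u\<in>W. \<Sum>v\<in>W. (\<lambda>j. \<Sum>k\<in>K. n k * (g (\<kappa> u) j * g j k * g k (\<kappa> u))) (\<kappa> v))"
    by (intro sum.cong refl parts)
  also have "\<dots> = (\<Sum>u\<in>W. (\<lambda>i. \<Sum>j\<in>K. n j * (\<Sum>k\<in>K. n k * (g i j * g j k * g k i))) (\<kappa> u))"
    by (intro sum.cong refl parts)
  also have "\<dots> = (\<Sum>i\<in>K. n i * (\<Sum>j\<in>K. n j * (\<Sum>k\<in>K. n k * (g i j * g j k * g k i))))"
    by (rule parts)
  finally have t: "6 * real (card (triangles G))
      = (\<Sum>i\<in>K. n i * (\<Sum>j\<in>K. n j * (\<Sum>k\<in>K. n k * (g i j * g j k * g k i))))" .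
  have n1: "1 \<le> n i" if "i \<in> K" for i
  proof -
    have "i \<in> {v \<in> W. \<kappa> v = i}" using that K \<kappa>(2) by auto
    then have "card {v \<in> W. \<kappa> v = i} > 0" using W(1) by (auto simp: card_gt_0_iff)
    then show ?thesis by (simp add: n_def)
  qed
  obtain p q r s where pqrs: "K = {p, q, r, s}" "distinct [p, q, r, s]"
  proof -
    obtain xs where xs: "set xs = K" "distinct xs" using finite_distinct_list[OF finK] by blast
    then have "length xs = 4" using K(2) distinct_card by metis
    then obtain p q r s where "xs = [p, q, r, s]"
      by (auto simp: numeral_eq_Suc length_Suc_conv)
    then show thesis using that[of p q r s] xs by auto
  qed
  have K_sum: "(\<Sum>i\<in>K. f i) = f p + f q + f r + f s" for f :: "'a \<Rightarrow> real"
    using pqrs by simp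
  have g: "g p p = 0" "g q q = 0" "g r r = 0" "g s s = 0" "g p q = 1" "g q p = 1" "g p r = 1"
    "g r p = 1" "g p s = 1" "g s p = 1" "g q r = 1" "g r q = 1" "g q s = 1" "g s q = 1"
    "g r s = 1" "g s r = 1"
    using pqrs(2) by (auto simp: g_def)
  define \<alpha> where "\<alpha> i = n i - 1" for i
  have nonneg: "0 \<le> \<alpha> p" "0 \<le> \<alpha> q" "0 \<le> \<alpha> r" "0 \<le> \<alpha> s"
    using n1[of p] n1[of q] n1[of r] n1[of s] pqrs(1) by (auto simp: \<alpha>_def)
  have n: "n i = \<alpha> i + 1" for i by (simp add: \<alpha>_def)
  have "real (card (edges G)) = n p * n q + n p * n r + n p * n s + n q * n r + n q * n s + n r * n s"
    using m by (simp add: K_sum g algebra_simps)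
  moreover have "real (card (triangles G)) = n p * n q * n r + n p * n q * n s + n p * n r * n s + n q * n r * n s"
    using t by (simp add: K_sum g algebra_simps)
  moreover have "real (card (triangles G)) + 2 = real (card (edges G))" using few by linarith
  ultimately have zero: "\<alpha> p * \<alpha> q + \<alpha> p * \<alpha> r + \<alpha> p * \<alpha> s + \<alpha> q * \<alpha> r + \<alpha> q * \<alpha> s + \<alpha> r * \<alpha> s
      + (\<alpha> p * \<alpha> q * \<alpha> r + \<alpha> p * \<alpha> q * \<alpha> s + \<alpha> p * \<alpha> r * \<alpha> s + \<alpha> q * \<alpha> r * \<alpha> s) = 0"
    unfolding n by (simp add: algebra_simps)
  have "0 \<le> \<alpha> p * \<alpha> q" "0 \<le> \<alpha> p * \<alpha> r" "0 \<le> \<alpha> p * \<alpha> s" "0 \<le> \<alpha> q * \<alpha> r" "0 \<le> \<alpha> q * \<alpha> s" "0 \<le> \<alpha> r * \<alpha> s"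
    "0 \<le> \<alpha> p * \<alpha> q * \<alpha> r" "0 \<le> \<alpha> p * \<alpha> q * \<alpha> s" "0 \<le> \<alpha> p * \<alpha> r * \<alpha> s" "0 \<le> \<alpha> q * \<alpha> r * \<alpha> s"
    using nonneg by simp_all
  then have prods: "\<alpha> p * \<alpha> q = 0" "\<alpha> p * \<alpha> r = 0" "\<alpha> p * \<alpha> s = 0" "\<alpha> q * \<alpha> r = 0" "\<alpha> q * \<alpha> s = 0" "\<alpha> r * \<alpha> s = 0"
    using zero by linarith+
  have "\<exists>big\<in>K. \<forall>i\<in>K - {big}. \<alpha> i = 0"
    using prods pqrs by (auto simp: mult_eq_0_iff)
  then obtain big where big: "big \<in> K" "\<And>i. i \<in> K \<Longrightarrow> i \<noteq> big \<Longrightarrow> \<alpha> i = 0" by blast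
  define T where "T = K - {big}"
  define P where "P = W - T"
  have single: "v = \<kappa> v" if v: "v \<in> W" "\<kappa> v \<in> T" for v
  proof -
    have "card {w \<in> W. \<kappa> w = \<kappa> v} = 1"
      using big(2)[of "\<kappa> v"] v(2) by (simp add: T_def \<alpha>_def n_def)
    then obtain y where y: "{w \<in> W. \<kappa> w = \<kappa> v} = {y}" by (auto simp: card_1_singleton_iff)
    have "v \<in> {w \<in> W. \<kappa> w = \<kappa> v}" "\<kappa> v \<in> {w \<in> W. \<kappa> w = \<kappa> v}"
      using v K \<kappa> by (auto simp: T_def)
    then show ?thesis unfolding y by simp
  qed
  have \<kappa>P: "\<kappa> v = big" if "v \<in> P" for v
  proof -
    have v: "v \<in> W" "v \<notin> T" using that by (auto simp: P_def)
    then have "\<kappa> v \<notin> T" using single[of v] by metis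
    then show ?thesis using \<kappa>(1)[OF v(1)] by (simp add: T_def)
  qed
  have \<kappa>T: "\<kappa> v = v" "v \<noteq> big" "v \<in> W" if "v \<in> T" for v using that \<kappa>(2) K by (auto simp: T_def)
  have TP: "T \<union> P = W" using K by (auto simp: T_def P_def)
  have "(u, v) \<in> parcs G \<longleftrightarrow> u \<in> T \<union> P \<and> v \<in> T \<union> P \<and> u \<noteq> v \<and> (u \<in> T \<or> v \<in> T)" for u v
  proof (cases "u \<in> W \<and> v \<in> W")
    case True
    then have "u \<in> T \<or> u \<in> P" "v \<in> T \<or> v \<in> P" using TP by auto
    then have "\<kappa> u \<noteq> \<kappa> v \<longleftrightarrow> u \<noteq> v \<and> (u \<in> T \<or> v \<in> T)"
      using \<kappa>P \<kappa>T by (metis DiffD2 P_def)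
    then show ?thesis using True TP parcs by auto
  next
    case False
    then show ?thesis using parcs TP by blast
  qed
  moreover have "card T = 3" using K big finK by (simp add: T_def)
  moreover have "finite P" "T \<inter> P = {}" using W by (auto simp: P_def)
  ultimately have "triangle_join G T P" by (auto simp: triangle_join_def)
  then show ?thesis by blast
qed

text \<open>
  For the second claim, \<open>cube_sum_bound\<close> leaves rank at most four, and the diagonal of the formula in
  \<open>clique_determines_kernel\<close> shows that the number \<open>\<beta> v\<close> of clique neighbours is 0 or 3. In the first
  case \<open>v\<close> is isolated; in the second it misses exactly one clique vertex \<open>\<kappa> v\<close>, and the formula makes
  two such vertices adjacent iff they miss different ones.
\<close>

lemma triangles_ge_if_four_clique:
  fixes s :: real
  assumes G: "pair_graph G"
    and K: "K \<subseteq> pverts G" "card K = 4" "\<And>u v. u \<in> K \<Longrightarrow> v \<in> K \<Longrightarrow> u \<noteq> v \<Longrightarrow> (u, v) \<in> parcs G"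
    and m: "real (card (edges G)) = s\<^sup>2 + 2" and s: "0 \<le> s" and lam: "largest_eigenvalue G \<ge> 1 + s"
  shows "s\<^sup>2 \<le> real (card (triangles G))"
    and "real (card (triangles G)) = s\<^sup>2 \<Longrightarrow> \<exists>T P. triangle_join G T P"
proof -
  interpret symmetric_kernel "pverts G" "adj G" using symmetric_kernel_adj[OF G] .
  obtain U where U: "eigenbasis U" using ex_eigenbasis by blast
  have finK: "finite K" using K(2) by (simp add: card_ge_0_finite)
  \<comment> \<open>The six edges of the clique give \<open>m \<ge> 6\<close>, that is, \<open>s \<ge> 2\<close>.\<close>
  have "card {B. B \<subseteq> K \<and> card B = 2} = 4 choose 2" using n_subsets[OF finK] K(2) by simp
  then have "6 \<le> card (edges G)"
    using card_mono[OF finite_edges[OF G] clique_edges[of K G]] K(3) by (simp add: choose_two)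
  then have "2\<^sup>2 \<le> s\<^sup>2" using m by simp
  then have s2: "2 \<le> s" using power2_le_imp_le[OF _ s] by simp
  have ne: "pverts G \<noteq> {}" using K by auto
  obtain x v0 where x: "x \<in> supported" "x v0 \<noteq> 0" "act x = (\<lambda>v. largest_eigenvalue G * x v)"
    using largest_eigenvalue_eigenvector[OF G ne] by (elim bexE conjE exE)
  obtain e where e: "e \<in> U" "rayleigh e = largest_eigenvalue G" using eigenvalue_in_basis[OF U x] by blast
  have clique: "adj G i j = (if i = j then 0 else 1)" if "i \<in> K" "j \<in> K" for i j
    using that K(3) parcs_irrefl[OF G] by (simp add: adj_def)
  have neg: "3 \<le> card {u \<in> U. rayleigh u \<le> -1}"
    using clique_forces_negative_eigenvalues[OF U K(1) clique] K(2) by simp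
  have "(\<Sum>u\<in>U. (rayleigh u)\<^sup>2) = (\<Sum>v\<in>pverts G. \<Sum>w\<in>pverts G. adj G v w)"
    unfolding trace_square[OF U, symmetric] by (intro sum.cong refl) (simp add: adj_def)
  then have squares: "(\<Sum>u\<in>U. (rayleigh u)\<^sup>2) = 2 * (s\<^sup>2 + 2)" using m by (simp add: sum_adj[OF G])
  have cubes: "(\<Sum>u\<in>U. rayleigh u ^ 3) = 6 * real (card (triangles G))"
    by (simp add: trace_cube[OF U, symmetric] sum_adj_triangles[OF G])
  note bound = cube_sum_bound[where r = rayleigh, OF eigenbasisD(1)[OF U] e(1) _ s2 neg squares]
  show "s\<^sup>2 \<le> real (card (triangles G))" using bound(1) e(2) lam cubes by simp
  assume t: "real (card (triangles G)) = s\<^sup>2"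
  then have rank: "card {u \<in> U. rayleigh u \<noteq> 0} \<le> card K" using bound(2) e(2) lam cubes K(2) by simp
  have det': "(real (card K) - 1) * (adj G v w + (\<Sum>i\<in>K. adj G v i * adj G i w))
      = (\<Sum>i\<in>K. adj G v i) * (\<Sum>i\<in>K. adj G i w)" if "v \<in> pverts G" "w \<in> pverts G" for v w
    by (rule clique_determines_kernel[OF U K(1)]) (use K(2) clique rank that in simp_all)
  have sym: "adj G v w = adj G w v" for v w using a_sym .
  define \<beta> where "\<beta> v = (\<Sum>i\<in>K. adj G v i)" for v
  have \<beta>': "(\<Sum>i\<in>K. adj G i v) = \<beta> v" for v
    unfolding \<beta>_def by (rule sum.cong[OF refl sym])
  have common: "(\<Sum>i\<in>K. adj G v i * adj G i w) = (\<Sum>i\<in>K. adj G v i * adj G w i)" for v w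
    by (intro sum.cong refl arg_cong[where f = "(*) _"] sym)
  have det: "3 * (adj G v w + (\<Sum>i\<in>K. adj G v i * adj G w i)) = \<beta> v * \<beta> w"
    if "v \<in> pverts G" "w \<in> pverts G" for v w
    using det'[OF that, unfolded common \<beta>' \<beta>_def[symmetric]] K(2) by simp
  have \<beta>: "\<beta> v = 0 \<or> \<beta> v = 3" if v: "v \<in> pverts G" for v
  proof -
    have "(\<Sum>i\<in>K. adj G v i * adj G v i) = \<beta> v" unfolding \<beta>_def by (rule sum.cong) (auto simp: adj_def)
    then have "3 * \<beta> v = \<beta> v * \<beta> v" using det[OF v v] parcs_irrefl[OF G] by (simp add: adj_def)
    then show ?thesis by auto
  qed
  have missing: "\<exists>i\<in>K. \<forall>j\<in>K. (v, j) \<in> parcs G \<longleftrightarrow> j \<noteq> i" if "\<beta> v = 3" for v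
  proof -
    have "\<beta> v = real (card {j \<in> K. (v, j) \<in> parcs G})"
      unfolding \<beta>_def adj_def using finK by (subst sum.inter_filter[symmetric]) auto
    then have "card {j \<in> K. (v, j) \<in> parcs G} = 3" using that by simp
    then have "card (K - {j \<in> K. (v, j) \<in> parcs G}) = 1"
      using finK K(2) by (subst card_Diff_subset) auto
    then obtain i where "K - {j \<in> K. (v, j) \<in> parcs G} = {i}" by (auto simp: card_1_singleton_iff)
    then show ?thesis by blast
  qed
  define \<kappa> where "\<kappa> v = (SOME i. i \<in> K \<and> (\<forall>j\<in>K. (v, j) \<in> parcs G \<longleftrightarrow> j \<noteq> i))" for v
  have \<kappa>: "\<kappa> v \<in> K" "\<And>j. j \<in> K \<Longrightarrow> (v, j) \<in> parcs G \<longleftrightarrow> j \<noteq> \<kappa> v" if "\<beta> v = 3" for v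
    using someI_ex[of "\<lambda>i. i \<in> K \<and> (\<forall>j\<in>K. (v, j) \<in> parcs G \<longleftrightarrow> j \<noteq> i)"] missing[OF that]
    unfolding \<kappa>_def by blast+
  define W where "W = {v \<in> pverts G. \<beta> v = 3}"
  have \<beta>K: "\<beta> i = 3" if "i \<in> K" for i
  proof -
    have "\<beta> i = (\<Sum>j\<in>K. 1 - (if j = i then 1 else 0))"
      unfolding \<beta>_def using clique that by (intro sum.cong) auto
    then show ?thesis using finK that K(2) by (simp add: sum_subtractf)
  qed
  have KW: "K \<subseteq> W" using \<beta>K K(1) by (auto simp: W_def)
  have \<kappa>K: "\<kappa> i = i" if "i \<in> K" for i
    using \<kappa>(2)[OF \<beta>K[OF that] that] parcs_irrefl[OF G] by auto
  have arcW: "u \<in> W \<and> v \<in> W" if "(u, v) \<in> parcs G" for u v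
  proof -
    have V: "u \<in> pverts G" "v \<in> pverts G" using parcs_verts[OF G that] by auto
    have "0 \<le> (\<Sum>i\<in>K. adj G u i * adj G v i)" by (intro sum_nonneg) (simp add: adj_def)
    then have "\<beta> u * \<beta> v > 0" using det[OF V] that by (simp add: adj_def)
    then show ?thesis using \<beta>[OF V(1)] \<beta>[OF V(2)] V by (auto simp: W_def)
  qed
  have arc: "(u, v) \<in> parcs G \<longleftrightarrow> \<kappa> u \<noteq> \<kappa> v" if "u \<in> W" "v \<in> W" for u v
  proof -
    have b: "\<beta> u = 3" "\<beta> v = 3" "u \<in> pverts G" "v \<in> pverts G" using that by (auto simp: W_def)
    have "(\<Sum>i\<in>K. adj G u i * adj G v i) = (\<Sum>i\<in>K. if i \<in> K - {\<kappa> u, \<kappa> v} then 1 else 0)"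
      using \<kappa>(2)[OF b(1)] \<kappa>(2)[OF b(2)] by (intro sum.cong) (auto simp: adj_def)
    also have "\<dots> = real (card (K - {\<kappa> u, \<kappa> v}))"
      using finK by (subst sum.inter_filter[symmetric]) (auto intro!: arg_cong[where f = card])
    also have "card (K - {\<kappa> u, \<kappa> v}) = 4 - card {\<kappa> u, \<kappa> v}"
      using \<kappa>(1)[OF b(1)] \<kappa>(1)[OF b(2)] K(2) by (subst card_Diff_subset) auto
    finally have "adj G u v + real (4 - card {\<kappa> u, \<kappa> v}) = 3" using det[OF b(3,4)] b(1,2) by simp
    then show ?thesis by (cases "\<kappa> u = \<kappa> v") (auto simp: adj_def split: if_splits)
  qed
  show "\<exists>T P. triangle_join G T P"
  proof (rule triangle_join_if_complete_four_partite[OF G KW K(2), of \<kappa>])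
    show "finite W" "W \<subseteq> pverts G" using finite_pverts[OF G] by (auto simp: W_def)
    show "\<kappa> v \<in> K" if "v \<in> W" for v using \<kappa>(1) that by (simp add: W_def)
    show "\<kappa> i = i" if "i \<in> K" for i using \<kappa>K that .
    show "(u, v) \<in> parcs G \<longleftrightarrow> u \<in> W \<and> v \<in> W \<and> \<kappa> u \<noteq> \<kappa> v" for u v using arcW arc by blast
    have "real (card (triangles G) + 2) = real (card (edges G))" using t m by simp
    then show "card (triangles G) + 2 = card (edges G)" by (simp only: of_nat_eq_iff)
  qed
qed

lemma triangle_join_if_three_edges:
  assumes G: "pair_graph G" and "card (edges G) = 3" "T \<in> triangles G"
  shows "triangle_join G T {}"
proof -
  have T: "card T = 3" "\<And>u v. u \<in> T \<Longrightarrow> v \<in> T \<Longrightarrow> u \<noteq> v \<Longrightarrow> (u, v) \<in> parcs G"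
    using assms(3) by (auto simp: triangles_def)
  have "finite T" using T(1) by (simp add: card_ge_0_finite)
  then have "card {B. B \<subseteq> T \<and> card B = 2} = 3" using T(1) by (simp add: n_subsets choose_two)
  then have eq: "{B. B \<subseteq> T \<and> card B = 2} = edges G"
    using card_subset_eq[OF finite_edges[OF G] clique_edges[of T G, OF T(2)]] assms(2) by simp
  have inT: "u \<in> T \<and> v \<in> T \<and> u \<noteq> v" if "(u, v) \<in> parcs G" for u v
  proof -
    have "{u, v} \<in> edges G" using that by (auto simp: edges_def)
    then have "{u, v} \<in> {B. B \<subseteq> T \<and> card B = 2}" by (simp only: eq)
    then have "{u, v} \<subseteq> T" by simp
    then show ?thesis using that parcs_irrefl[OF G] by auto
  qed
  have "(u, v) \<in> parcs G \<longleftrightarrow> u \<in> T \<and> v \<in> T \<and> u \<noteq> v" for u v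
    using inT[of u v] T(2)[of u v] by argo
  then have "parcs G = {(u, v). u \<in> T \<union> {} \<and> v \<in> T \<union> {} \<and> u \<noteq> v \<and> (u \<in> T \<or> v \<in> T)}"
    by auto
  then show ?thesis using T(1) by (simp add: triangle_join_def)
qed

section \<open>The triangle bound\<close>

theorem theorem1p1:
  fixes G :: "'a pair_pre_digraph" and m :: nat
  assumes "pair_graph G"
    and "card (edges G) = m"
    and "m \<ge> 3"
    and "largest_eigenvalue G \<ge> 1 + sqrt (real m - 2)"
  shows "card (triangles G) \<ge> m - 2 \<and>
    (card (triangles G) = m - 2 \<longleftrightarrow>
      3 dvd (m - 3) \<and>
      digraph_iso (with_proj (delete_isolated G))
        (with_proj (graph_join (complete_graph 3) (empty_graph ((m - 3) div 3)))))"
proof -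
  note G = assms(1)
  define s where "s = sqrt (real m - 2)"
  have s1: "1 \<le> s" and s2: "s\<^sup>2 = real m - 2" using assms(3) by (simp_all add: s_def)
  let ?l = "largest_eigenvalue G"
  have lam: "1 + s \<le> ?l" using assms(4) by (simp add: s_def)
  have bound: "real m - 2 \<le> real (card (triangles G)) \<and>
    (real (card (triangles G)) = real m - 2 \<longrightarrow> (\<exists>T P. triangle_join G T P))"
  proof (cases "\<exists>K \<subseteq> pverts G. card K = 4 \<and> (\<forall>u\<in>K. \<forall>v\<in>K. u \<noteq> v \<longrightarrow> (u, v) \<in> parcs G)")
    case True
    then obtain K where K: "K \<subseteq> pverts G" "card K = 4"
      "\<And>u v. u \<in> K \<Longrightarrow> v \<in> K \<Longrightarrow> u \<noteq> v \<Longrightarrow> (u, v) \<in> parcs G" by blast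
    have ms: "real (card (edges G)) = s\<^sup>2 + 2" using s2 assms(2) by simp
    show ?thesis using triangles_ge_if_four_clique[OF G K ms _ lam] s1 s2 by simp
  next
    case False
    have "edges G \<noteq> {}" using assms(2,3) by auto
    then have ne: "pverts G \<noteq> {}" using parcs_verts[OF G] by (fastforce simp: edges_def)
    have "?l ^ 3 \<le> real m * ?l + 2 * real (card (triangles G))"
      using largest_eigenvalue_cube_le[OF G False _ ne] lam s1 assms(2) by simp
    then have "?l * (?l\<^sup>2 - real m) \<le> 2 * real (card (triangles G))"
      by (simp add: power2_eq_square power3_eq_cube algebra_simps)
    \<comment> \<open>Note \<open>(1 + s)\<^sup>2 - m = 2 * s - 1\<close>, since \<open>m = s\<^sup>2 + 2\<close>.\<close>
    moreover have "(1 + s) * (2 * s - 1) \<le> ?l * (?l\<^sup>2 - real m)"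
    proof (rule mult_mono)
      have "(1 + s)\<^sup>2 \<le> ?l\<^sup>2" using lam s1 by (intro power_mono) auto
      then show "2 * s - 1 \<le> ?l\<^sup>2 - real m" using s2 by (simp add: power2_eq_square algebra_simps)
    qed (use lam s1 in auto)
    ultimately have t: "2 * s\<^sup>2 + (s - 1) \<le> 2 * real (card (triangles G))"
      by (simp add: power2_eq_square algebra_simps)
    have "\<exists>T P. triangle_join G T P" if eq: "real (card (triangles G)) = real m - 2"
    proof -
      have "s = 1" using t eq s1 s2 by linarith
      then have m3: "card (edges G) = 3" using s2 assms(2) by simp
      have "card (triangles G) = 1" using eq m3 assms(2) by simp
      then obtain T where "T \<in> triangles G" by (metis card.empty all_not_in_conv zero_neq_one)
      then show ?thesis using triangle_join_if_three_edges[OF G m3] by blast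
    qed
    moreover have "real m - 2 \<le> real (card (triangles G))" using t s1 s2 by linarith
    ultimately show ?thesis by blast
  qed
  show ?thesis
  proof (intro conjI iffI)
    show "m - 2 \<le> card (triangles G)" using bound by linarith
  next
    assume "card (triangles G) = m - 2"
    then have "real (card (triangles G)) = real m - 2" using assms(3) by simp
    then obtain T P where J: "triangle_join G T P" using bound by blast
    have "m = 3 * card P + 3" using card_edges_triangle_join[OF G J] assms(2) by simp
    then show "3 dvd (m - 3)" "digraph_iso (with_proj (delete_isolated G))
        (with_proj (graph_join (complete_graph 3) (empty_graph ((m - 3) div 3))))"
      using triangle_join_imp_join_iso[OF G J] by simp_all
  next
    assume "3 dvd (m - 3) \<and> digraph_iso (with_proj (delete_isolated G))
        (with_proj (graph_join (complete_graph 3) (empty_graph ((m - 3) div 3))))"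
    then obtain T P where J: "triangle_join G T P" "card P = (m - 3) div 3" and d: "3 dvd (m - 3)"
      using join_iso_imp_triangle_join[OF G] by blast
    then show "card (triangles G) = m - 2"
      using card_triangles_triangle_join[OF G J(1)] assms(3) by auto
  qed
qed

end
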